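(* Let $\mathcal M$ be a factor von Neumann algebra and $\xi\in\mathbb C$ a nonzero scalar. Let $L:\mathcal M\to\mathcal M$ be an additive $\xi$-Lie derivation. (1) If $\xi=1$ and $\deg(\mathcal M)\ge3$, then there exist an additive derivation $\tau:\mathcal M\to\mathcal M$ and an additive functional $h:\mathcal M\to\mathbb C$ with $h([A,B])=0$ for all $A,B\in\mathcal M$, such that $L(A)=\tau(A)+h(A)I$ for all $A\in\mathcal M$. (2) If $\xi\ne1$, then $L$ is an additive derivation and $L(\xi A)=\xi L(A)$ for all $A\in\mathcal M$.
   Context: A factor is a von Neumann algebra whose center is $\mathbb C I$, where $I$ is its unit. For $\xi\in\mathbb C$, $[A,B]_\xi=AB-\xi BA$ and $[A,B]=AB-BA$. An additive map $L:\mathcal M\to\mathcal M$ is an additive $\xi$-Lie derivation if $L([A,B]_\xi)=[L(A),B]_\xi+[A,L(B)]_\xi$ for all $A,B\in\mathcal M$. An additive map $\tau:\mathcal M\to\mathcal M$ is an additive derivation if $\tau(AB)=\tau(A)B+A\tau(B)$ for all $A,B\in\mathcal M$. (Additive maps are not assumed linear.) Degree of algebraicity: with $\mathcal Z(\mathcal M)$ the center of $\mathcal M$, an element $A\in\mathcal M$ is algebraic over $\mathcal Z(\mathcal M)$ if there exist $Z_0,\dots,Z_n\in\mathcal Z(\mathcal M)$ with $Z_n\ne0$ and $Z_0+Z_1A+\cdots+Z_nA^n=0$; the least such $n$ is $\deg(A)$, and $\deg(A)=\infty$ if $A$ is not algebraic. $\deg(\mathcal M)=\sup\{\deg(A):A\in\mathcal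 M\}$.
   Formalization: In part (2) the case where M = ℂI and ξ is transcendental is excluded, since there L(a) = D(a) − a/(1−ξ), with D an additive derivation of ℂ and D(ξ) = 1, is an additive ξ-Lie derivation but not a derivation. *)

theory Defs
  imports "HOL-Analysis.Analysis" "HOL-Library.Extended_Nat"
begin

section \<open>Complex Hilbert spaces\<close>

class scaleC =
  fixes scaleC :: "complex \<Rightarrow> 'a \<Rightarrow> 'a"  (infixr "*\<^sub>C" 75)

text \<open>
  The inner product is linear in its first argument. Positive definiteness and the
  fact that the norm is the one induced by the inner product are both contained in
  \<open>cinner_self\<close>; completeness comes from \<^class>\<open>banach\<close>.
\<close>

class complex_hilbert = banach + scaleC +
  fixes cinner :: "'a \<Rightarrow> 'a \<Rightarrow> complex"
  assumes scaleC_add_right: "c *\<^sub>C (x + y) = c *\<^sub>C x + c *\<^sub>C y"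
    and scaleC_add_left: "(c + d) *\<^sub>C x = c *\<^sub>C x + d *\<^sub>C x"
    and scaleC_scaleC: "c *\<^sub>C d *\<^sub>C x = (c * d) *\<^sub>C x"
    and scaleC_of_real: "complex_of_real r *\<^sub>C x = r *\<^sub>R x"
    and cinner_commute: "cinner x y = cnj (cinner y x)"
    and cinner_add_left: "cinner (x + y) z = cinner x z + cinner y z"
    and cinner_scaleC_left: "cinner (c *\<^sub>C x) y = c * cinner x y"
    and cinner_self: "cinner x x = complex_of_real ((norm x)\<^sup>2)"

instantiation complex :: complex_hilbert
begin

definition scaleC_complex :: "complex \<Rightarrow> complex \<Rightarrow> complex"
  where "scaleC_complex c x = c * x"

definition cinner_complex :: "complex \<Rightarrow> complex \<Rightarrow> complex"
  where "cinner_complex x y = x * cnj y"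

instance
  by standard
    (auto simp: scaleC_complex_def cinner_complex_def algebra_simps scaleR_conv_of_real
      simp flip: complex_norm_square)

end

lemma norm_scaleC:
  fixes x :: "'h::complex_hilbert"
  shows "norm (c *\<^sub>C x) = cmod c * norm x"
proof -
  have "cinner (c *\<^sub>C x) (c *\<^sub>C x) = c * cnj c * cinner x x"
    by (metis cinner_commute cinner_scaleC_left complex_cnj_mult mult.assoc)
  then have "complex_of_real ((norm (c *\<^sub>C x))\<^sup>2) = complex_of_real ((cmod c * norm x)\<^sup>2)"
    by (simp add: cinner_self power_mult_distrib flip: complex_norm_square)
  then have "(norm (c *\<^sub>C x))\<^sup>2 = (cmod c * norm x)\<^sup>2"
    using of_real_eq_iff by blast
  then show ?thesis
    by (simp add: power2_eq_iff_nonneg)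
qed

lemma bounded_linear_scaleC: "bounded_linear (\<lambda>x::'h::complex_hilbert. c *\<^sub>C x)"
proof (rule bounded_linear_intro[where K = "cmod c"])
  show "c *\<^sub>C (r *\<^sub>R x) = r *\<^sub>R c *\<^sub>C x" for r and x :: 'h
    by (simp add: scaleC_scaleC mult.commute flip: scaleC_of_real)
qed (simp_all add: scaleC_add_right norm_scaleC mult.commute)


section \<open>Bounded operators\<close>

text \<open>
  \<^const>\<open>bounded_linear\<close> only refers to the real scalars, hence the additional
  complex homogeneity.
\<close>

typedef (overloaded) 'h bop =
  "{f :: 'h::complex_hilbert \<Rightarrow> 'h. bounded_linear f \<and> (\<forall>c x. f (c *\<^sub>C x) = c *\<^sub>C f x)}"
  morphisms bop_apply Bop
proof
  show "id \<in> {f :: 'h \<Rightarrow> 'h. bounded_linear f \<and> (\<forall>c x. f (c *\<^sub>C x) = c *\<^sub>C f x)}"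
    by (simp add: id_def)
qed

setup_lifting type_definition_bop

lemma scaleC_zero_right [simp]: "c *\<^sub>C (0::'h::complex_hilbert) = 0"
  using bounded_linear.linear[OF bounded_linear_scaleC] linear_0 by blast

lemma scaleC_minus_right: "c *\<^sub>C (- x) = - (c *\<^sub>C (x::'h::complex_hilbert))"
  using bounded_linear.linear[OF bounded_linear_scaleC] linear_neg by blast

lemma scaleC_diff_right: "c *\<^sub>C (x - y) = c *\<^sub>C x - c *\<^sub>C (y::'h::complex_hilbert)"
  using bounded_linear.linear[OF bounded_linear_scaleC] linear_diff by blast

text \<open>
  Multiplication is composition. There is no instance of \<^class>\<open>ring_1\<close>, since
  the zero Hilbert space is allowed and there \<open>0 = 1\<close>.
\<close>

instantiation bop :: (complex_hilbert) "{ring, monoid_mult, scaleC}"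
begin

lift_definition zero_bop :: "'a bop" is "\<lambda>x. 0"
  by simp

lift_definition one_bop :: "'a bop" is "\<lambda>x. x"
  by simp

lift_definition plus_bop :: "'a bop \<Rightarrow> 'a bop \<Rightarrow> 'a bop" is "\<lambda>f g x. f x + g x"
  by (simp add: bounded_linear_add scaleC_add_right)

lift_definition minus_bop :: "'a bop \<Rightarrow> 'a bop \<Rightarrow> 'a bop" is "\<lambda>f g x. f x - g x"
  by (simp add: bounded_linear_sub scaleC_diff_right)

lift_definition uminus_bop :: "'a bop \<Rightarrow> 'a bop" is "\<lambda>f x. - f x"
  by (simp add: bounded_linear_minus scaleC_minus_right)

lift_definition times_bop :: "'a bop \<Rightarrow> 'a bop \<Rightarrow> 'a bop" is "\<lambda>f g x. f (g x)"
  by (simp add: bounded_linear_compose)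

lift_definition scaleC_bop :: "complex \<Rightarrow> 'a bop \<Rightarrow> 'a bop" is "\<lambda>c f x. c *\<^sub>C f x"
  by (simp add: bounded_linear_compose[OF bounded_linear_scaleC] scaleC_scaleC mult.commute)

instance
  by standard
    (transfer; simp add: fun_eq_iff algebra_simps linear_add[OF bounded_linear.linear])+

end


section \<open>Von Neumann algebras and factors\<close>

definition is_adjoint :: "'h::complex_hilbert bop \<Rightarrow> 'h bop \<Rightarrow> bool"
  where "is_adjoint A B \<longleftrightarrow> (\<forall>x y. cinner (bop_apply A x) y = cinner x (bop_apply B y))"

definition commutant :: "'h::complex_hilbert bop set \<Rightarrow> 'h bop set"
  where "commutant M = {T. \<forall>A\<in>M. T * A = A * T}"

text \<open>
  A self-adjoint set of bounded operators that equals its double commutant. Being a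
  commutant, such a set is automatically a subalgebra containing \<open>1\<close>. The
  adjoint of an operator exists and is unique, so the first condition says that \<open>M\<close>
  is closed under taking adjoints.
\<close>

definition von_neumann_algebra :: "'h::complex_hilbert bop set \<Rightarrow> bool"
  where "von_neumann_algebra M \<longleftrightarrow>
    (\<forall>A\<in>M. \<exists>B\<in>M. is_adjoint A B) \<and> commutant (commutant M) = M"

definition center :: "'h::complex_hilbert bop set \<Rightarrow> 'h bop set"
  where "center M = {Z \<in> M. \<forall>A\<in>M. Z * A = A * Z}"

definition scalar_ops :: "'h::complex_hilbert bop set"
  where "scalar_ops = range (\<lambda>c. c *\<^sub>C 1)"

definition factor :: "'h::complex_hilbert bop set \<Rightarrow> bool"
  where "factor M \<longleftrightarrow> von_neumann_algebra M \<and> center M = scalar_ops"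


section \<open>Degree of algebraicity\<close>

definition algebraic_rel :: "'h::complex_hilbert bop set \<Rightarrow> 'h bop \<Rightarrow> nat \<Rightarrow> bool"
  where "algebraic_rel M A n \<longleftrightarrow>
    (\<exists>Z :: nat \<Rightarrow> 'h bop. (\<forall>i\<le>n. Z i \<in> center M) \<and> Z n \<noteq> 0 \<and> (\<Sum>i\<le>n. Z i * A ^ i) = 0)"

definition elem_deg :: "'h::complex_hilbert bop set \<Rightarrow> 'h bop \<Rightarrow> enat"
  where "elem_deg M A =
    (if \<exists>n. algebraic_rel M A n then enat (LEAST n. algebraic_rel M A n) else \<infinity>)"

definition alg_deg :: "'h::complex_hilbert bop set \<Rightarrow> enat"
  where "alg_deg M = (SUP A\<in>M. elem_deg M A)"


section \<open>Additive maps and derivations\<close>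

text \<open>
  Maps on \<open>M\<close> are total functions on all bounded operators; only their values on \<open>M\<close>
  are constrained.
\<close>

definition xi_commutator :: "complex \<Rightarrow> 'h::complex_hilbert bop \<Rightarrow> 'h bop \<Rightarrow> 'h bop"
  where "xi_commutator \<xi> A B = A * B - \<xi> *\<^sub>C (B * A)"

definition additive_on :: "'h::complex_hilbert bop set \<Rightarrow> ('h bop \<Rightarrow> 'b::plus) \<Rightarrow> bool"
  where "additive_on M f \<longleftrightarrow> (\<forall>A\<in>M. \<forall>B\<in>M. f (A + B) = f A + f B)"

definition additive_derivation :: "'h::complex_hilbert bop set \<Rightarrow> ('h bop \<Rightarrow> 'h bop) \<Rightarrow> bool"
  where "additive_derivation M \<tau> \<longleftrightarrow>
    \<tau> \<in> M \<rightarrow> M \<and> additive_on M \<tau> \<and> (\<forall>A\<in>M. \<forall>B\<in>M. \<tau> (A * B) = \<tau> A * B + A * \<tau> B)"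

definition additive_xi_lie_derivation ::
    "complex \<Rightarrow> 'h::complex_hilbert bop set \<Rightarrow> ('h bop \<Rightarrow> 'h bop) \<Rightarrow> bool"
  where "additive_xi_lie_derivation \<xi> M L \<longleftrightarrow>
    L \<in> M \<rightarrow> M \<and> additive_on M L \<and>
    (\<forall>A\<in>M. \<forall>B\<in>M. L (xi_commutator \<xi> A B) = xi_commutator \<xi> (L A) B + xi_commutator \<xi> A (L B))"

text \<open>
  The one-dimensional factor \<open>M = \<complex>1\<close> behaves differently for \<open>\<xi> \<noteq> 1\<close>: if \<open>\<xi>\<close> is
  transcendental, choose an additive derivation \<open>D\<close> of the field \<open>\<complex>\<close> with \<open>D \<xi> = 1\<close>. Then
  \<open>L a = D a - a / (1 - \<xi>)\<close> is an additive \<open>\<xi>\<close>-Lie derivation but not a derivation, as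
  \<open>L 1 \<noteq> 0\<close>. For algebraic \<open>\<xi>\<close> every derivation of \<open>\<complex>\<close> vanishes at \<open>\<xi>\<close> and this does not
  occur. The theorem excludes exactly the case \<open>M = scalar_ops\<close> with \<open>\<xi>\<close> transcendental.
\<close>

end

theory Submission
  imports Defs
begin

text \<open>
  A factor is a prime ring. If it is not \<open>\<complex>1\<close>, it contains a nontrivial projection, and the centre
  of each corner \<open>qMq\<close> consists of the scalar multiples of \<open>q\<close>. For \<open>\<xi> = 1\<close> these facts permit
  Martindale's Peirce decomposition argument: after subtracting an inner derivation, \<open>L\<close> preserves
  the off-diagonal corners and preserves the diagonal ones up to scalars, and removing these
  scalars leaves a derivation. The case \<open>M = \<complex>1\<close> is trivial with \<open>\<tau> = 0\<close>.
  For \<open>\<xi> = -1\<close> the map is a Jordan derivation, hence a derivation by Herstein's theorem. For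
  \<open>\<xi> \<noteq> \<plusminus>1\<close> the defect \<open>L(AB) - L(A)B - AL(B)\<close> is a scalar multiple of \<open>\<xi>AB + BA\<close>; since the defect is
  a Hochschild cocycle, a nonzero multiple would make all commutators central. Finally, on \<open>\<complex>1\<close> the
  map \<open>a \<mapsto> L(a) - aL(1)\<close> is a field derivation, so it vanishes at an algebraic \<open>\<xi>\<close>.
\<close>

section \<open>Operators and inner products\<close>

text \<open>Everything has to be extracted from the bicommutant definition, and two devices take the
  place of spectral theory. Projections arise as range projections: the projection onto the closed
  span of the ranges of elements of \<open>M\<close> commutes with \<open>commutant M\<close>, hence
  lies in \<open>M\<close>; for the left ideal \<open>M * B\<close> it is even central, which yields
  primeness. Scalars arise from a sign argument: if the double commutant of a self-adjoint
  \<open>A\<close> has no zero divisors, then \<open>(|B| - B) * (|B| + B) = 0\<close> with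
  \<open>B = A - t 1\<close> puts \<open>A\<close> on one side of each real \<open>t\<close>, and
  the resulting cut of the real line is the scalar. Carried out below a projection \<open>q\<close>,
  this turns primeness into the statement on corner centres; with \<open>q = 1\<close> it shows that
  a factor without nontrivial projections is \<open>\<complex>1\<close>. The algebra after that
  lives in prime rings without 2-torsion. Since \<open>L\<close> is only additive, complex scalars
  cannot be pulled out of it, and several decisive cancellations have the form
  \<open>w = - w\<close>.\<close>

lemma bop_eqI: "(\<And>x. bop_apply A x = bop_apply B x) \<Longrightarrow> A = B"
  by (simp add: bop_apply_inject[symmetric] ext)

lemmas bop_apply_simps [simp] = zero_bop.rep_eq one_bop.rep_eq plus_bop.rep_eq minus_bop.rep_eq
  uminus_bop.rep_eq times_bop.rep_eq scaleC_bop.rep_eq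

lemma bounded_linear_bop_apply: "bounded_linear (bop_apply A)"
  using bop_apply[of A] by simp

lemma bop_apply_scaleC [simp]: "bop_apply A (c *\<^sub>C x) = c *\<^sub>C bop_apply A x"
  using bop_apply[of A] by simp

lemma bop_apply_add [simp]: "bop_apply A (x + y) = bop_apply A x + bop_apply A y"
  by (simp add: bounded_linear.linear[OF bounded_linear_bop_apply] linear_add)

lemma bop_apply_diff [simp]: "bop_apply A (x - y) = bop_apply A x - bop_apply A y"
  by (simp add: bounded_linear.linear[OF bounded_linear_bop_apply] linear_diff)

lemma bop_apply_zero [simp]: "bop_apply A 0 = 0"
  by (simp add: bounded_linear.linear[OF bounded_linear_bop_apply] linear_0)

lemma scaleC_one [simp]: "1 *\<^sub>C (x::'h::complex_hilbert) = x"
  using scaleC_of_real[of 1 x] by simp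

lemma scaleC_zero_left [simp]: "0 *\<^sub>C (x::'h::complex_hilbert) = 0"
  using scaleC_of_real[of 0 x] by simp

lemma scaleC_minus_left: "(- c) *\<^sub>C (x::'h::complex_hilbert) = - (c *\<^sub>C x)"
  using scaleC_add_left[of c "-c" x] by (simp add: eq_neg_iff_add_eq_0 add.commute)

lemma scaleC_diff_left: "(c - d) *\<^sub>C (x::'h::complex_hilbert) = c *\<^sub>C x - d *\<^sub>C x"
  using scaleC_add_left[of c "-d" x] by (simp add: scaleC_minus_left)

lemma bop_apply_scaleR [simp]: "bop_apply A (r *\<^sub>R x) = r *\<^sub>R bop_apply A x"
  by (simp flip: scaleC_of_real)

lemma bop_scaleC_mult_left [simp]: "(c *\<^sub>C A) * B = c *\<^sub>C (A * B)" for A B :: "'h::complex_hilbert bop"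
  by (rule bop_eqI) simp

lemma bop_scaleC_mult_right [simp]: "A * (c *\<^sub>C B) = c *\<^sub>C (A * B)" for A B :: "'h::complex_hilbert bop"
  by (rule bop_eqI) simp

lemma bop_scaleC_add_right: "c *\<^sub>C (A + B) = c *\<^sub>C A + c *\<^sub>C B" for A B :: "'h::complex_hilbert bop"
  by (rule bop_eqI) (simp add: scaleC_add_right)

lemma bop_scaleC_diff_right: "c *\<^sub>C (A - B) = c *\<^sub>C A - c *\<^sub>C B" for A B :: "'h::complex_hilbert bop"
  by (rule bop_eqI) (simp add: scaleC_diff_right)

lemma bop_scaleC_add_left: "(c + d) *\<^sub>C A = c *\<^sub>C A + d *\<^sub>C A" for A :: "'h::complex_hilbert bop"
  by (rule bop_eqI) (simp add: scaleC_add_left)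

lemma bop_scaleC_diff_left: "(c - d) *\<^sub>C A = c *\<^sub>C A - d *\<^sub>C A" for A :: "'h::complex_hilbert bop"
  by (rule bop_eqI) (simp add: scaleC_diff_left)

lemma bop_scaleC_minus_left: "(- c) *\<^sub>C A = - (c *\<^sub>C A)" for A :: "'h::complex_hilbert bop"
  by (rule bop_eqI) (simp add: scaleC_minus_left)

lemma bop_scaleC_scaleC [simp]: "c *\<^sub>C d *\<^sub>C A = (c * d) *\<^sub>C A" for A :: "'h::complex_hilbert bop"
  by (rule bop_eqI) (simp add: scaleC_scaleC)

lemma bop_scaleC_one [simp]: "1 *\<^sub>C A = A" for A :: "'h::complex_hilbert bop"
  by (rule bop_eqI) simp

lemma bop_scaleC_zero_left [simp]: "0 *\<^sub>C A = 0" for A :: "'h::complex_hilbert bop"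
  by (rule bop_eqI) simp

lemma bop_scaleC_zero_right [simp]: "c *\<^sub>C 0 = (0 :: 'h::complex_hilbert bop)"
  by (rule bop_eqI) simp

lemma bop_scaleC_eq_0_iff [simp]: "c *\<^sub>C A = 0 \<longleftrightarrow> c = 0 \<or> A = 0" for A :: "'h::complex_hilbert bop"
proof -
  have "A = 0" if "c *\<^sub>C A = 0" "c \<noteq> 0"
  proof -
    have "A = (1 / c) *\<^sub>C c *\<^sub>C A" using \<open>c \<noteq> 0\<close> by simp
    also have "\<dots> = 0" by (simp add: that(1) del: bop_scaleC_scaleC)
    finally show ?thesis .
  qed
  then show ?thesis by auto
qed

lemma cinner_add_right: "cinner x (y + z) = cinner x y + cinner x z"
  by (metis cinner_add_left cinner_commute complex_cnj_add)

lemma cinner_scaleC_right: "cinner x (c *\<^sub>C y) = cnj c * cinner x y"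
  by (metis cinner_commute cinner_scaleC_left complex_cnj_mult)

lemma cinner_minus_left: "cinner (- x) y = - cinner x y"
  using cinner_scaleC_left[of "-1" x y] by (simp add: scaleC_minus_left)

lemma cinner_minus_right: "cinner x (- y) = - cinner x y"
  using cinner_scaleC_right[of x "-1" y] by (simp add: scaleC_minus_left)

lemma cinner_diff_left: "cinner (x - y) z = cinner x z - cinner y z"
  using cinner_add_left[of x "-y" z] by (simp add: cinner_minus_left)

lemma cinner_diff_right: "cinner x (y - z) = cinner x y - cinner x z"
  using cinner_add_right[of x y "-z"] by (simp add: cinner_minus_right)

lemma cinner_zero_left [simp]: "cinner 0 x = 0"
  using cinner_scaleC_left[of 0 x x] by simp

lemma cinner_zero_right [simp]: "cinner x 0 = 0"
  using cinner_scaleC_right[of x 0 x] by simp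

lemma cinner_self_eq_0_iff [simp]: "cinner x x = 0 \<longleftrightarrow> x = 0"
  by (simp add: cinner_self)

lemma Re_cinner_commute: "Re (cinner x y) = Re (cinner y x)"
  by (subst cinner_commute) simp

lemma norm_add_sq: "(norm (x + y))\<^sup>2 = (norm x)\<^sup>2 + 2 * Re (cinner x y) + (norm y)\<^sup>2"
  for x y :: "'h::complex_hilbert"
proof -
  have "complex_of_real ((norm (x + y))\<^sup>2)
      = of_real ((norm x)\<^sup>2) + (cinner x y + cinner y x) + of_real ((norm y)\<^sup>2)"
    by (simp only: cinner_self[symmetric] cinner_add_left cinner_add_right) algebra
  then have "(norm (x + y))\<^sup>2 = Re (of_real ((norm x)\<^sup>2) + (cinner x y + cinner y x) + of_real ((norm y)\<^sup>2))"
    by (metis Re_complex_of_real)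
  then show ?thesis
    by (simp add: Re_cinner_commute[of y x])
qed

lemma norm_diff_sq: "(norm (x - y))\<^sup>2 = (norm x)\<^sup>2 - 2 * Re (cinner x y) + (norm y)\<^sup>2"
  for x y :: "'h::complex_hilbert"
  using norm_add_sq[of x "-y"] by (simp add: cinner_minus_right)

lemma Re_cinner_le: "Re (cinner x y) \<le> norm x * norm y"
proof -
  have "(norm (x + y))\<^sup>2 \<le> (norm x + norm y)\<^sup>2"
    by (simp add: norm_triangle_ineq power_mono)
  then show ?thesis by (simp add: norm_add_sq power2_sum)
qed

lemma Im_cinner: "Im (cinner x y) = Re (cinner x (\<i> *\<^sub>C y))"
  by (simp add: cinner_scaleC_right)

lemma bounded_linear_Re_cinner: "bounded_linear (\<lambda>x. Re (cinner x y))"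
proof (rule bounded_linear_intro[where K = "norm y"])
  show "Re (cinner (r *\<^sub>R x) y) = r *\<^sub>R Re (cinner x y)" for r x
    by (simp add: cinner_scaleC_left flip: scaleC_of_real)
  show "norm (Re (cinner x y)) \<le> norm x * norm y" for x
    using Re_cinner_le[of x y] Re_cinner_le[of "-x" y] by (simp add: cinner_minus_left)
qed (simp add: cinner_add_left)

lemma closed_orthogonal: "closed {x. cinner x y = 0}"
proof -
  have c: "continuous_on UNIV (\<lambda>x. Re (cinner x z))" for z :: 'a
    by (rule linear_continuous_on[OF bounded_linear_Re_cinner])
  have "{x. cinner x y = 0} = {x. Re (cinner x y) = 0} \<inter> {x. Re (cinner x (\<i> *\<^sub>C y)) = 0}"
    by (auto simp: complex_eq_iff Im_cinner)
  also have "closed \<dots>"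
    by (intro closed_Int closed_Collect_eq c continuous_on_const)
  finally show ?thesis .
qed

section \<open>Orthogonal projections onto closed complex subspaces\<close>

definition csubspace :: "'h::complex_hilbert set \<Rightarrow> bool"
  where "csubspace K \<longleftrightarrow> 0 \<in> K \<and> (\<forall>x\<in>K. \<forall>y\<in>K. x + y \<in> K) \<and> (\<forall>c. \<forall>x\<in>K. c *\<^sub>C x \<in> K)"

lemma csubspace_diff: "csubspace K \<Longrightarrow> x \<in> K \<Longrightarrow> y \<in> K \<Longrightarrow> x - y \<in> K"
  unfolding csubspace_def by (metis diff_conv_add_uminus scaleC_minus_left scaleC_one)

lemma nearest_point_exists:
  fixes K :: "'h::complex_hilbert set"
  assumes "closed K" "csubspace K"
  obtains k where "k \<in> K" "\<And>y. y \<in> K \<Longrightarrow> norm (x - k) \<le> norm (x - y)"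
proof -
  have ne: "K \<noteq> {}" using assms(2) by (auto simp: csubspace_def)
  define d where "d = infdist x K"
  have d0: "0 \<le> d" by (simp add: d_def infdist_nonneg)
  have dle: "d \<le> norm (x - y)" if "y \<in> K" for y
    using infdist_le[OF that, of x] by (simp add: d_def dist_norm)
  have "\<exists>k\<in>K. norm (x - k) < d + 1 / Suc n" for n
  proof (rule ccontr)
    assume "\<not> ?thesis"
    then have "d + 1 / Suc n \<le> d"
      unfolding d_def infdist_notempty[OF ne] using ne
      by (intro cINF_greatest) (auto simp: dist_norm not_less)
    then show False by simp
  qed
  then obtain k where kK: "\<And>n. k n \<in> K" and kd: "\<And>n. norm (x - k n) < d + 1 / Suc n"
    by metis
  \<comment> \<open>The midpoint of \<open>k m\<close> and \<open>k n\<close> lies in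
    \<open>K\<close>, so its distance from \<open>x\<close> is at least \<open>d\<close>; the
    parallelogram law then leaves only this much for \<open>k m - k n\<close>.\<close>
  have parallelogram: "(norm (k m - k n))\<^sup>2 \<le> 4 * ((d + 1 / Suc N)\<^sup>2 - d\<^sup>2)"
    if "N \<le> m" "N \<le> n" for m n N
  proof -
    have le: "(norm (x - k j))\<^sup>2 \<le> (d + 1 / Suc N)\<^sup>2" if "N \<le> j" for j
    proof (rule power_mono)
      have "1 / real (Suc j) \<le> 1 / Suc N" using that by (simp add: frac_le)
      then show "norm (x - k j) \<le> d + 1 / Suc N" using kd[of j] by linarith
    qed simp
    let ?mid = "(1/2) *\<^sub>C (k m + k n)"
    have "?mid \<in> K" using assms(2) kK by (auto simp: csubspace_def)
    then have "d\<^sup>2 \<le> (norm (x - ?mid))\<^sup>2" using d0 dle by (simp add: power_mono)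
    moreover have "(x - k m) + (x - k n) = 2 *\<^sub>C (x - ?mid)"
      by (simp add: scaleC_diff_right scaleC_scaleC)
         (metis (no_types, opaque_lifting) add_diff_add one_add_one scaleC_add_left scaleC_one)
    then have "(norm ((x - k m) + (x - k n)))\<^sup>2 = 4 * (norm (x - ?mid))\<^sup>2"
      by (simp add: norm_scaleC power_mult_distrib)
    moreover have "(norm ((x - k m) + (x - k n)))\<^sup>2 + (norm ((x - k m) - (x - k n)))\<^sup>2
        = 2 * (norm (x - k m))\<^sup>2 + 2 * (norm (x - k n))\<^sup>2"
      unfolding norm_add_sq norm_diff_sq by simp
    moreover have "norm ((x - k m) - (x - k n)) = norm (k m - k n)"
      by (simp add: norm_minus_commute)
    ultimately show ?thesis using le[OF that(1)] le[OF that(2)] by simp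
  qed
  have "Cauchy k"
  proof (rule metric_CauchyI)
    fix e :: real assume "e > 0"
    have "(\<lambda>N. 4 * ((d + 1 / Suc N)\<^sup>2 - d\<^sup>2)) \<longlonglongrightarrow> 4 * ((d + 0)\<^sup>2 - d\<^sup>2)"
      by (intro tendsto_intros) (use LIMSEQ_inverse_real_of_nat in \<open>simp add: inverse_eq_divide\<close>)
    then have "\<forall>\<^sub>F N in sequentially. 4 * ((d + 1 / Suc N)\<^sup>2 - d\<^sup>2) < e\<^sup>2"
      using \<open>e > 0\<close> by (intro order_tendstoD(2)) auto
    then obtain N where N: "4 * ((d + 1 / Suc N)\<^sup>2 - d\<^sup>2) < e\<^sup>2"
      by (auto simp: eventually_sequentially)
    have "dist (k m) (k n) < e" if "m \<ge> N" "n \<ge> N" for m n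
      using parallelogram[OF that] N \<open>e > 0\<close> unfolding dist_norm
      by (meson le_less_trans less_imp_le power2_less_imp_less)
    then show "\<exists>N. \<forall>m\<ge>N. \<forall>n\<ge>N. dist (k m) (k n) < e" by blast
  qed
  then obtain l where l: "k \<longlonglongrightarrow> l" using Cauchy_convergent convergentD by blast
  show ?thesis
  proof
    show "l \<in> K" using assms(1) kK l closed_sequentially by blast
    have lim1: "(\<lambda>n. norm (x - k n)) \<longlonglongrightarrow> norm (x - l)" by (intro tendsto_intros l)
    have lim2: "(\<lambda>n. d + 1 / Suc n) \<longlonglongrightarrow> d + 0"
      by (intro tendsto_intros) (use LIMSEQ_inverse_real_of_nat in \<open>simp add: inverse_eq_divide\<close>)
    have "norm (x - l) \<le> d"
      using LIMSEQ_le[OF lim1 lim2] kd by (auto intro: less_imp_le)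
    then show "norm (x - l) \<le> norm (x - y)" if "y \<in> K" for y using dle[OF that] by linarith
  qed
qed

lemma orthogonal_decomposition_exists:
  fixes K :: "'h::complex_hilbert set"
  assumes "closed K" "csubspace K"
  obtains k where "k \<in> K" "\<And>y. y \<in> K \<Longrightarrow> cinner (x - k) y = 0"
proof -
  obtain k where kK: "k \<in> K" and k: "\<And>y. y \<in> K \<Longrightarrow> norm (x - k) \<le> norm (x - y)"
    using nearest_point_exists[OF assms] by metis
  have Re0: "Re (cinner (x - k) y) = 0" if "y \<in> K" for y
  proof (cases "y = 0")
    case False
    define a where "a = Re (cinner (x - k) y)"
    \<comment> \<open>The step along \<open>y\<close> that minimises the distance. As
      \<open>k\<close> is already nearest, the gain \<open>a\<^sup>2 / (norm y)\<^sup>2\<close> must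
      vanish.\<close>
    define s where "s = a / (norm y)\<^sup>2"
    have "k + complex_of_real s *\<^sub>C y \<in> K" using assms(2) kK that by (simp add: csubspace_def)
    then have "norm (x - k) \<le> norm ((x - k) - of_real s *\<^sub>C y)" using k by (simp add: diff_diff_eq)
    then have "(norm (x - k))\<^sup>2 \<le> (norm ((x - k) - of_real s *\<^sub>C y))\<^sup>2" by (simp add: power_mono)
    also have "\<dots> = (norm (x - k))\<^sup>2 - 2 * s * a + s\<^sup>2 * (norm y)\<^sup>2"
      unfolding norm_diff_sq by (simp add: cinner_scaleC_right a_def norm_scaleC power_mult_distrib)
    also have "\<dots> = (norm (x - k))\<^sup>2 - a\<^sup>2 / (norm y)\<^sup>2"
      using False by (simp add: s_def field_simps power2_eq_square)
    finally have "a\<^sup>2 / (norm y)\<^sup>2 \<le> 0" by simp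
    then have "a = 0" using False by (simp add: divide_le_0_iff)
    then show ?thesis by (simp add: a_def)
  qed simp
  show ?thesis
  proof
    show "cinner (x - k) y = 0" if "y \<in> K" for y
      using Re0[OF that] Re0[of "\<i> *\<^sub>C y"] assms(2) that
      by (auto simp: complex_eq_iff Im_cinner csubspace_def)
  qed (fact kK)
qed

text \<open>A bound by 1 suffices: the operators built from functions below are orthogonal
  projections and a limit of contractions.\<close>

lemma BopI:
  fixes f :: "'h::complex_hilbert \<Rightarrow> 'h"
  assumes "\<And>x y. f (x + y) = f x + f y" "\<And>c x. f (c *\<^sub>C x) = c *\<^sub>C f x"
    and "\<And>x. norm (f x) \<le> norm x"
  shows "bop_apply (Bop f) = f"
proof -
  have "bounded_linear f"
    by (rule bounded_linear_intro[where K = 1]) (use assms in \<open>simp_all flip: scaleC_of_real\<close>)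
  then show ?thesis using assms by (simp add: Bop_inverse)
qed

text \<open>The third property records uniqueness of the orthogonal decomposition. Linearity here,
  and commutation with the commutant later, are obtained by exhibiting a candidate for it.\<close>

lemma orthogonal_projection_exists:
  fixes K :: "'h::complex_hilbert set"
  assumes "closed K" "csubspace K"
  obtains P where "\<And>x. bop_apply P x \<in> K" "\<And>x y. y \<in> K \<Longrightarrow> cinner (x - bop_apply P x) y = 0"
    "\<And>x k. k \<in> K \<Longrightarrow> (\<And>y. y \<in> K \<Longrightarrow> cinner (x - k) y = 0) \<Longrightarrow> bop_apply P x = k"
proof -
  have "\<forall>x. \<exists>k. k \<in> K \<and> (\<forall>y\<in>K. cinner (x - k) y = 0)"
    using orthogonal_decomposition_exists[OF assms] by metis
  then obtain f where fK: "\<And>x. f x \<in> K" and f: "\<And>x y. y \<in> K \<Longrightarrow> cinner (x - f x) y = 0"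
    by metis
  have uniq: "f x = k" if "k \<in> K" "\<And>y. y \<in> K \<Longrightarrow> cinner (x - k) y = 0" for x k
  proof -
    have m: "f x - k \<in> K" using assms(2) fK that(1) by (rule csubspace_diff)
    have "cinner (f x - k) (f x - k) = cinner ((x - k) - (x - f x)) (f x - k)" by simp
    also have "\<dots> = 0" unfolding cinner_diff_left[of "x - k"] using that(2)[OF m] f[OF m] by simp
    finally show ?thesis by simp
  qed
  have add: "f (x + y) = f x + f y" for x y
  proof (rule uniq)
    show "f x + f y \<in> K" using assms(2) fK by (simp add: csubspace_def)
    show "cinner (x + y - (f x + f y)) z = 0" if "z \<in> K" for z
      using f[OF that, of x] f[OF that, of y]
      by (simp add: add_diff_add cinner_add_left)
  qed
  have scale: "f (c *\<^sub>C x) = c *\<^sub>C f x" for c x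
  proof (rule uniq)
    show "c *\<^sub>C f x \<in> K" using assms(2) fK by (simp add: csubspace_def)
    show "cinner (c *\<^sub>C x - c *\<^sub>C f x) z = 0" if "z \<in> K" for z
      using f[OF that, of x] by (simp add: cinner_scaleC_left flip: scaleC_diff_right)
  qed
  have "norm (f x) \<le> norm x" for x
  proof -
    have "(norm ((x - f x) + f x))\<^sup>2 = (norm (x - f x))\<^sup>2 + (norm (f x))\<^sup>2"
      unfolding norm_add_sq using f[OF fK] by simp
    then show ?thesis by (simp add: power2_le_imp_le)
  qed
  then have "bop_apply (Bop f) = f" using add scale by (intro BopI)
  then show ?thesis using that[of "Bop f"] fK f uniq by simp
qed

section \<open>Closed spans of sets of vectors\<close>

lemma closure_span_invariant:
  assumes "bounded_linear f" "f ` G \<subseteq> span G" "x \<in> closure (span G)"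
  shows "f x \<in> closure (span G)"
proof -
  have "f ` span G \<subseteq> span G"
    using assms(2) bounded_linear.linear[OF assms(1)] by (metis linear_span_image span_minimal subspace_span)
  then show ?thesis
    using closure_bounded_linear_image_subset[OF assms(1), of "span G"] assms(3) closure_mono by blast
qed

text \<open>\<open>span\<close> is the real span, so stability under complex scalars has to come
  from \<open>G\<close> and is carried to the closure by continuity.\<close>

lemma csubspace_closure_span:
  fixes G :: "'h::complex_hilbert set"
  assumes "\<And>c x. x \<in> G \<Longrightarrow> c *\<^sub>C x \<in> G"
  shows "csubspace (closure (span G))"
  unfolding csubspace_def
proof (intro conjI ballI allI)
  show "0 \<in> closure (span G)" using closure_subset span_zero by blast
  show "x + y \<in> closure (span G)" if "x \<in> closure (span G)" "y \<in> closure (span G)" for x y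
  proof -
    obtain u v where "\<And>n. u n \<in> span G" "u \<longlonglongrightarrow> x" "\<And>n. v n \<in> span G" "v \<longlonglongrightarrow> y"
      using \<open>x \<in> _\<close> \<open>y \<in> _\<close> unfolding closure_sequential by blast
    then show ?thesis
      unfolding closure_sequential
      by (intro exI[of _ "\<lambda>n. u n + v n"]) (auto intro: span_add tendsto_add)
  qed
  show "c *\<^sub>C x \<in> closure (span G)" if "x \<in> closure (span G)" for c x
    by (rule closure_span_invariant[OF bounded_linear_scaleC _ that]) (use assms span_base in blast)
qed

lemma orthogonal_closure_span:
  assumes "\<And>g. g \<in> G \<Longrightarrow> cinner g y = 0" "k \<in> closure (span G)"
  shows "cinner k y = 0"
proof -
  have "subspace {x. cinner x y = 0}"
    by (auto simp: subspace_def cinner_add_left cinner_scaleC_left simp flip: scaleC_of_real)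
  then have "closure (span G) \<subseteq> {x. cinner x y = 0}"
    using assms(1) closed_orthogonal by (intro closure_minimal span_minimal) auto
  then show ?thesis using assms(2) by blast
qed

lemma bop_eq_0_closure_span:
  assumes "\<And>g. g \<in> G \<Longrightarrow> bop_apply E g = 0" "k \<in> closure (span G)"
  shows "bop_apply E k = 0"
proof -
  have "subspace {x. bop_apply E x = 0}" by (auto simp: subspace_def)
  moreover have "closed {x. bop_apply E x = 0}"
    by (intro closed_Collect_eq linear_continuous_on bounded_linear_bop_apply continuous_on_const)
  ultimately have "closure (span G) \<subseteq> {x. bop_apply E x = 0}"
    using assms(1) by (intro closure_minimal span_minimal) auto
  then show ?thesis using assms(2) by blast
qed

section \<open>Adjoints and von Neumann algebras\<close>

lemma is_adjointD: "is_adjoint A B \<Longrightarrow> cinner (bop_apply A x) y = cinner x (bop_apply B y)"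
  by (simp add: is_adjoint_def)

lemma is_adjoint_commute: "is_adjoint A B \<longleftrightarrow> is_adjoint B A"
  unfolding is_adjoint_def by (metis cinner_commute)

lemma is_adjoint_unique:
  assumes "is_adjoint A B" "is_adjoint A C" shows "B = C"
proof (rule bop_eqI)
  fix y
  have "cinner x (bop_apply B y - bop_apply C y) = 0" for x
    using assms[THEN is_adjointD, of x y] by (simp add: cinner_diff_right)
  then show "bop_apply B y = bop_apply C y"
    using cinner_self_eq_0_iff eq_iff_diff_eq_0 by blast
qed

lemma is_adjoint_one: "is_adjoint 1 1"
  by (simp add: is_adjoint_def)

lemma is_adjoint_add: "is_adjoint A A' \<Longrightarrow> is_adjoint B B' \<Longrightarrow> is_adjoint (A + B) (A' + B')"
  by (simp add: is_adjoint_def cinner_add_left cinner_add_right)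

lemma is_adjoint_diff: "is_adjoint A A' \<Longrightarrow> is_adjoint B B' \<Longrightarrow> is_adjoint (A - B) (A' - B')"
  by (simp add: is_adjoint_def cinner_diff_left cinner_diff_right)

lemma is_adjoint_mult: "is_adjoint A A' \<Longrightarrow> is_adjoint B B' \<Longrightarrow> is_adjoint (A * B) (B' * A')"
  by (simp add: is_adjoint_def)

lemma is_adjoint_scaleC: "is_adjoint A A' \<Longrightarrow> is_adjoint (c *\<^sub>C A) (cnj c *\<^sub>C A')"
  by (simp add: is_adjoint_def cinner_scaleC_left cinner_scaleC_right)

text \<open>Polarisation with a single test vector: at \<open>x + A x\<close> the cross terms of the
  form are both the squared norm of \<open>A x\<close>, because \<open>A\<close> is
  self-adjoint.\<close>

lemma selfadjoint_eq_0:
  assumes "is_adjoint A A" "\<And>x. Re (cinner (bop_apply A x) x) = 0"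
  shows "A = 0"
proof (rule bop_eqI)
  fix x
  let ?y = "bop_apply A x"
  have "Re (cinner (bop_apply A (x + ?y)) (x + ?y)) = 2 * Re (cinner ?y ?y)"
    using assms(2)[of x] assms(2)[of ?y] is_adjointD[OF assms(1), of ?y x]
    by (simp add: cinner_add_left cinner_add_right)
  then show "bop_apply A x = bop_apply 0 x"
    unfolding assms(2) by (simp add: cinner_self)
qed

lemma commutant_mono: "S \<subseteq> M \<Longrightarrow> commutant M \<subseteq> commutant S"
  by (auto simp: commutant_def)

lemma von_neumann_bicommutant: "von_neumann_algebra M \<Longrightarrow> S \<subseteq> M \<Longrightarrow> commutant (commutant S) \<subseteq> M"
  unfolding von_neumann_algebra_def using commutant_mono by metis

lemma commutant_closed:
  "0 \<in> commutant S" "1 \<in> commutant S"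
  "A \<in> commutant S \<Longrightarrow> B \<in> commutant S \<Longrightarrow> A + B \<in> commutant S"
  "A \<in> commutant S \<Longrightarrow> B \<in> commutant S \<Longrightarrow> A - B \<in> commutant S"
  "A \<in> commutant S \<Longrightarrow> B \<in> commutant S \<Longrightarrow> A * B \<in> commutant S"
  "A \<in> commutant S \<Longrightarrow> c *\<^sub>C A \<in> commutant S"
proof -
  show "A * B \<in> commutant S" if "A \<in> commutant S" "B \<in> commutant S"
    using that unfolding commutant_def by (auto simp: mult.assoc) (metis mult.assoc)
qed (auto simp: commutant_def algebra_simps)

lemma von_neumann_closed:
  assumes "von_neumann_algebra M"
  shows "0 \<in> M" "1 \<in> M"
    "A \<in> M \<Longrightarrow> B \<in> M \<Longrightarrow> A + B \<in> M" "A \<in> M \<Longrightarrow> B \<in> M \<Longrightarrow> A - B \<in> M"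
    "A \<in> M \<Longrightarrow> B \<in> M \<Longrightarrow> A * B \<in> M" "A \<in> M \<Longrightarrow> c *\<^sub>C A \<in> M"
  using commutant_closed[where S = "commutant M"] assms by (auto simp: von_neumann_algebra_def)

text \<open>Von Neumann algebras are Baer *-rings: the left annihilator of a subset \<open>S\<close> is generated by the
  projection \<open>1 - P\<close>, where \<open>P\<close> projects onto the closed span of the ranges of the elements of \<open>S\<close>.\<close>

lemma von_neumann_range_projection:
  assumes M: "von_neumann_algebra M" and S: "S \<subseteq> M"
  obtains P where "P \<in> M" "is_adjoint P P" "P * P = P" "\<And>D. D \<in> S \<Longrightarrow> P * D = D"
    "\<And>E. (\<And>D. D \<in> S \<Longrightarrow> E * D = 0) \<Longrightarrow> E * P = 0"
proof -
  define G where "G = {bop_apply D x | D x. D \<in> S}"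
  define K where "K = closure (span G)"
  have scale: "c *\<^sub>C g \<in> G" if g: "g \<in> G" for c g
  proof -
    obtain D x where D: "D \<in> S" "g = bop_apply D x" using g by (auto simp: G_def)
    then have "c *\<^sub>C g = bop_apply D (c *\<^sub>C x)" by simp
    then show ?thesis using D(1) unfolding G_def by blast
  qed
  have K: "closed K" "csubspace K" by (auto simp: K_def intro: csubspace_closure_span scale)
  have GK: "g \<in> K" if "g \<in> G" for g using that K_def closure_subset span_base by blast
  have rangeK: "bop_apply D x \<in> K" if "D \<in> S" for D x
    using that by (intro GK) (auto simp: G_def)
  obtain P where PK: "\<And>x. bop_apply P x \<in> K" and perp: "\<And>x y. y \<in> K \<Longrightarrow> cinner (x - bop_apply P x) y = 0"
    and uniq: "\<And>x k. k \<in> K \<Longrightarrow> (\<And>y. y \<in> K \<Longrightarrow> cinner (x - k) y = 0) \<Longrightarrow> bop_apply P x = k"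
    by (rule orthogonal_projection_exists[OF K]) blast
  have fixK: "bop_apply P k = k" if "k \<in> K" for k by (rule uniq[OF that]) simp
  show ?thesis
  proof
    show "P * P = P" by (rule bop_eqI) (simp add: fixK PK)
    show "P * D = D" if "D \<in> S" for D
      by (rule bop_eqI) (simp add: fixK rangeK[OF that])
    show "E * P = 0" if E: "\<And>D. D \<in> S \<Longrightarrow> E * D = 0" for E
    proof (rule bop_eqI)
      fix x
      have "bop_apply E g = 0" if "g \<in> G" for g
        using that E unfolding G_def by clarsimp (metis times_bop.rep_eq zero_bop.rep_eq)
      then show "bop_apply (E * P) x = bop_apply 0 x"
        using bop_eq_0_closure_span[of G E, OF _ PK[unfolded K_def]] by simp
    qed
    show "is_adjoint P P"
      unfolding is_adjoint_def
    proof (intro allI)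
      fix x y
      have "cinner (bop_apply P x) y = cinner (bop_apply P x) (bop_apply P y)"
        using perp[OF PK[of x], of y] cinner_commute[of "bop_apply P x" "y - bop_apply P y"]
        by (simp add: cinner_diff_right)
      also have "\<dots> = cinner x (bop_apply P y)"
        using perp[OF PK[of y], of x] by (simp add: cinner_diff_left)
      finally show "cinner (bop_apply P x) y = cinner x (bop_apply P y)" .
    qed
    show "P \<in> M"
    proof -
      \<comment> \<open>\<open>T\<close> preserves \<open>K\<close> because it commutes with each
        \<open>D\<close> in \<open>S\<close>. It also preserves the orthogonal complement: a vector
        orthogonal to the range of \<open>D\<close> is killed by the adjoint \<open>D'\<close>,
        which lies in \<open>M\<close> and so commutes with \<open>T\<close> as well. The adjoint of
        \<open>T\<close> itself is never formed.\<close>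
      have "P * T = T * P" if "T \<in> commutant M" for T
      proof (rule bop_eqI)
        fix x
        have TD: "T * D = D * T" if "D \<in> M" for D
          using that \<open>T \<in> commutant M\<close> by (simp add: commutant_def)
        have TD': "bop_apply T (bop_apply D v) = bop_apply D (bop_apply T v)" if "D \<in> M" for D v
          using arg_cong[OF TD[OF that], of "\<lambda>A. bop_apply A v"] by simp
        have "bop_apply P (bop_apply T x) = bop_apply T (bop_apply P x)"
        proof (rule uniq)
          have "bop_apply T ` G \<subseteq> G"
            using S TD' unfolding G_def by blast
          then have "bop_apply T ` G \<subseteq> span G"
            using span_superset by blast
          then show "bop_apply T (bop_apply P x) \<in> K"
            unfolding K_def by (rule closure_span_invariant[OF bounded_linear_bop_apply _ PK[unfolded K_def]])
          let ?w = "x - bop_apply P x"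
          have "cinner g (bop_apply T ?w) = 0" if g: "g \<in> G" for g
          proof -
            obtain D v where D: "D \<in> S" "g = bop_apply D v" using g by (auto simp: G_def)
            obtain D' where D': "D' \<in> M" "is_adjoint D D'"
              using M S D(1) unfolding von_neumann_algebra_def by blast
            have "cinner (bop_apply D' ?w) u = 0" for u
              using perp[OF rangeK[OF D(1)]] is_adjointD[OF D'(2)[unfolded is_adjoint_commute[of D]]]
              by (simp del: bop_apply_diff)
            then have "bop_apply D' ?w = 0" using cinner_self_eq_0_iff by blast
            then have "bop_apply D' (bop_apply T ?w) = 0"
              using TD'[OF D'(1), of ?w] by (simp del: bop_apply_diff)
            then show ?thesis using D(2) is_adjointD[OF D'(2)] by (simp del: bop_apply_diff)
          qed
          then have "cinner y (bop_apply T ?w) = 0" if "y \<in> K" for y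
            using orthogonal_closure_span[of G, OF _ that[unfolded K_def]] by blast
          then show "cinner (bop_apply T x - bop_apply T (bop_apply P x)) y = 0" if "y \<in> K" for y
            using that cinner_commute[of "bop_apply T ?w" y] by simp
        qed
        then show "bop_apply (P * T) x = bop_apply (T * P) x" by simp
      qed
      then have "P \<in> commutant (commutant M)" by (simp add: commutant_def)
      then show ?thesis using M by (simp add: von_neumann_algebra_def)
    qed
  qed
qed

section \<open>Absolute values of self-adjoint operators\<close>

text \<open>The iteration \<open>Y \<mapsto> (X + Y\<^sup>2) / 2\<close> with \<open>X = 1 - A\<^sup>2\<close> converges to \<open>1 - \<bar>A\<bar>\<close>; its speed of
  convergence is controlled by the scalar iteration \<open>y \<mapsto> (1 + y\<^sup>2) / 2\<close>.\<close>

lemma absolute_value_of_contraction: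
  assumes adj: "is_adjoint A A" and contr: "\<And>x. norm (bop_apply A x) \<le> norm x"
  obtains S where "S * S = A * A" "\<And>T. T * A = A * T \<Longrightarrow> S * T = T * S"
    "\<And>x. 0 \<le> Re (cinner (bop_apply S x) x)"
proof -
  define X where "X = 1 - A * A"
  define Y where "Y = rec_nat 0 (\<lambda>_ Y. (1/2) *\<^sub>C (X + Y * Y))"
  define y :: "nat \<Rightarrow> real" where "y = rec_nat 0 (\<lambda>_ y. (1 + y * y) / 2)"
  have Y0: "Y 0 = 0" and YS: "Y (Suc n) = (1/2) *\<^sub>C (X + Y n * Y n)" for n by (simp_all add: Y_def)
  have y0: "y 0 = 0" and yS: "y (Suc n) = (1 + y n * y n) / 2" for n by (simp_all add: y_def)
  have Xcontr: "norm (bop_apply X x) \<le> norm x" for x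
  proof -
    let ?z = "bop_apply A x"
    have "(norm (bop_apply X x))\<^sup>2 = (norm x)\<^sup>2 - 2 * (norm ?z)\<^sup>2 + (norm (bop_apply A ?z))\<^sup>2"
    proof -
      have "Re (cinner x (bop_apply A ?z)) = (norm ?z)\<^sup>2"
        by (metis Re_complex_of_real adj cinner_self is_adjointD)
      then show ?thesis by (simp add: X_def norm_diff_sq)
    qed
    also have "\<dots> \<le> (norm x)\<^sup>2"
      using power_mono[OF contr[of ?z] norm_ge_zero, of 2] zero_le_power2[of "norm ?z"] by linarith
    finally show ?thesis by (rule power2_le_imp_le) simp
  qed
  \<comment> \<open>\<open>Y n\<close> is a polynomial in \<open>A * A\<close>, so it commutes with
    whatever commutes with \<open>A\<close>, and in particular with every
    \<open>Y m\<close>.\<close>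
  have commA: "Y n * T = T * Y n" if "T * A = A * T" for n T
  proof (induction n)
    case (Suc n)
    have comm_sq: "B * B * T = T * (B * B)" if "B * T = T * B" for B
      using that by (metis mult.assoc)
    have "X * T = T * X" using comm_sq[OF \<open>T * A = A * T\<close>[symmetric]]
      by (simp add: X_def left_diff_distrib right_diff_distrib)
    moreover have "Y n * Y n * T = T * (Y n * Y n)" using Suc by (rule comm_sq)
    ultimately show ?case by (simp add: YS distrib_left distrib_right)
  qed (simp add: Y0)
  have commY: "Y n * Y m = Y m * Y n" for m n
    using commA commA[of A] by metis
  have ybound: "0 \<le> y n \<and> y n \<le> 1" for n
  proof (induction n)
    case (Suc n)
    then have "y n * y n \<le> 1" by (simp add: mult_le_one)
    then show ?case by (simp add: yS)
  qed (simp add: y0)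
  have ydiff: "y (Suc (Suc n)) - y (Suc n) = (y (Suc n) + y n) * (y (Suc n) - y n) / 2" for n
    unfolding yS[of "Suc n"] by (simp only: yS[of n]) (simp add: field_simps)
  have ymono: "y n \<le> y (Suc n)" for n
    using sum_squares_bound[of "y n" 1] by (simp add: yS power2_eq_square)
  have Ybound: "norm (bop_apply (Y n) x) \<le> y n * norm x" for n x
  proof (induction n arbitrary: x)
    case (Suc n)
    have "norm (bop_apply (Y n) (bop_apply (Y n) x)) \<le> y n * (y n * norm x)"
      using Suc order_trans ybound mult_left_mono by metis
    then have "norm (bop_apply X x + bop_apply (Y n) (bop_apply (Y n) x)) \<le> norm x + y n * (y n * norm x)"
      using Xcontr[of x] norm_triangle_le by (metis add_mono)
    then show ?case by (simp add: YS yS norm_scaleC field_simps)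
  qed (simp add: Y0 y0)
  \<comment> \<open>Because the operators \<open>Y n\<close> commute, the difference of two squares
    factors just as in \<open>ydiff\<close>, and the scalar increments dominate the operator
    increments by induction.\<close>
  have Ystep: "norm (bop_apply (Y (Suc n)) x - bop_apply (Y n) x) \<le> (y (Suc n) - y n) * norm x" for n x
  proof (induction n arbitrary: x)
    case 0
    then show ?case using Ybound[of "Suc 0" x] by (simp add: Y0 y0)
  next
    case (Suc n)
    let ?u = "bop_apply (Y (Suc n)) x - bop_apply (Y n) x"
    have "Y (Suc (Suc n)) - Y (Suc n) = (1/2) *\<^sub>C (Y (Suc n) * Y (Suc n) - Y n * Y n)"
      unfolding YS[of "Suc n"] by (subst (3) YS) (simp flip: bop_scaleC_diff_right)
    also have "\<dots> = (1/2) *\<^sub>C ((Y (Suc n) + Y n) * (Y (Suc n) - Y n))"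
      using commY[of n "Suc n"] by (simp add: algebra_simps)
    finally have "bop_apply (Y (Suc (Suc n)) - Y (Suc n)) x
        = (1/2) *\<^sub>C (bop_apply (Y (Suc n)) ?u + bop_apply (Y n) ?u)"
      by (simp del: bop_apply_diff)
    then have eq: "bop_apply (Y (Suc (Suc n))) x - bop_apply (Y (Suc n)) x
        = (1/2) *\<^sub>C (bop_apply (Y (Suc n)) ?u + bop_apply (Y n) ?u)"
      by (simp only: minus_bop.rep_eq)
    have "norm (bop_apply (Y (Suc n)) ?u + bop_apply (Y n) ?u) \<le> y (Suc n) * norm ?u + y n * norm ?u"
      by (intro norm_triangle_le add_mono Ybound)
    also have "\<dots> = (y (Suc n) + y n) * norm ?u" by (simp add: distrib_right)
    also have "\<dots> \<le> (y (Suc n) + y n) * ((y (Suc n) - y n) * norm x)"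
      using ybound[of n] ybound[of "Suc n"] by (intro mult_left_mono Suc) auto
    finally show ?case unfolding eq ydiff by (simp add: norm_scaleC)
  qed
  have Ydist: "norm (bop_apply (Y m) x - bop_apply (Y n) x) \<le> (y m - y n) * norm x" if "n \<le> m" for m n x
    using that
  proof (induction m rule: dec_induct)
    case (step m)
    have "bop_apply (Y (Suc m)) x - bop_apply (Y n) x
        = (bop_apply (Y (Suc m)) x - bop_apply (Y m) x) + (bop_apply (Y m) x - bop_apply (Y n) x)" by simp
    also have "norm \<dots> \<le> (y (Suc m) - y m) * norm x + (y m - y n) * norm x"
      by (intro norm_triangle_le add_mono Ystep step.IH)
    finally show ?case by (simp add: algebra_simps)
  qed simp
  have "convergent y"
    using ymono ybound by (intro Bseq_monoseq_convergent BseqI'[of _ 1]) (auto intro: incseq_SucI simp: monoseq_iff)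
  then have "Cauchy y" by (rule convergent_Cauchy)
  have "convergent (\<lambda>n. bop_apply (Y n) x)" for x
  proof -
    have "Cauchy (\<lambda>n. bop_apply (Y n) x)"
    proof (rule metric_CauchyI)
      fix e :: real assume "e > 0"
      then obtain N where N: "\<And>m n. m \<ge> N \<Longrightarrow> n \<ge> N \<Longrightarrow> dist (y m) (y n) < e / (norm x + 1)"
        using \<open>Cauchy y\<close> by (metis add_nonneg_pos divide_pos_pos metric_CauchyD norm_ge_zero zero_less_one)
      have *: "dist (bop_apply (Y m) x) (bop_apply (Y n) x) < e" if "m \<ge> N" "n \<ge> N" "n \<le> m" for m n
      proof -
        have "y m - y n < e / (norm x + 1)" using N[of m n] that by (simp add: dist_real_def)
        then have "(y m - y n) * norm x \<le> e / (norm x + 1) * norm x"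
            by (intro mult_right_mono) auto
        also have "\<dots> < e"
          using \<open>e > 0\<close> add_nonneg_pos[OF norm_ge_zero zero_less_one, of x]
          by (simp add: pos_divide_less_eq distrib_left)
        finally show ?thesis using Ydist[OF that(3), of x] by (simp add: dist_norm)
      qed
      have "dist (bop_apply (Y m) x) (bop_apply (Y n) x) < e" if "m \<ge> N" "n \<ge> N" for m n
        using *[of m n] *[of n m] that by (metis dist_commute nle_le)
      then show "\<exists>N. \<forall>m\<ge>N. \<forall>n\<ge>N. dist (bop_apply (Y m) x) (bop_apply (Y n) x) < e" by blast
    qed
    then show ?thesis by (simp add: Cauchy_convergent_iff)
  qed
  then obtain f where f: "\<And>x. (\<lambda>n. bop_apply (Y n) x) \<longlonglongrightarrow> f x"
    unfolding convergent_def by metis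
  have fnorm: "norm (f x) \<le> norm x" for x
  proof (rule LIMSEQ_le_const2[OF tendsto_norm[OF f]])
    have "norm (bop_apply (Y n) x) \<le> norm x" for n
      using Ybound[of n x] ybound[of n] by (meson mult_left_le_one_le norm_ge_zero order_trans)
    then show "\<exists>N. \<forall>n\<ge>N. norm (bop_apply (Y n) x) \<le> norm x" by blast
  qed
  define F where "F = Bop f"
  have F: "bop_apply F = f"
    unfolding F_def
  proof (rule BopI)
    show "f (x + z) = f x + f z" for x z
      using tendsto_add[OF f f, of x z] f[of "x + z"] by (auto intro: LIMSEQ_unique)
    show "f (c *\<^sub>C x) = c *\<^sub>C f x" for c x
      using bounded_linear.tendsto[OF bounded_linear_scaleC f, of c x] f[of "c *\<^sub>C x"]
      by (auto intro: LIMSEQ_unique)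
  qed (fact fnorm)
  \<comment> \<open>Pointwise convergence does not pass to products by itself; the uniform bound 1
    on the operators \<open>Y n\<close> moves the limit past the outer factor.\<close>
  have sq: "(\<lambda>n. bop_apply (Y n) (bop_apply (Y n) x)) \<longlonglongrightarrow> f (f x)" for x
  proof -
    have "(\<lambda>n. bop_apply (Y n) (bop_apply (Y n) x - f x)) \<longlonglongrightarrow> 0"
    proof (rule Lim_null_comparison)
      show "\<forall>\<^sub>F n in sequentially. norm (bop_apply (Y n) (bop_apply (Y n) x - f x)) \<le> norm (bop_apply (Y n) x - f x)"
        using Ybound ybound by (intro always_eventually allI) (meson mult_left_le_one_le norm_ge_zero order_trans)
      show "(\<lambda>n. norm (bop_apply (Y n) x - f x)) \<longlonglongrightarrow> 0"
        using f[of x] by (simp add: tendsto_norm_zero LIM_zero)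
    qed
    from tendsto_add[OF this f[of "f x"]] show ?thesis by simp
  qed
  have F2: "2 *\<^sub>C F = X + F * F"
  proof (rule bop_eqI)
    fix x
    have "(\<lambda>n. 2 *\<^sub>C bop_apply (Y (Suc n)) x) \<longlonglongrightarrow> 2 *\<^sub>C f x"
      by (intro bounded_linear.tendsto[OF bounded_linear_scaleC] LIMSEQ_Suc f)
    moreover have "(\<lambda>n. 2 *\<^sub>C bop_apply (Y (Suc n)) x) = (\<lambda>n. bop_apply X x + bop_apply (Y n) (bop_apply (Y n) x))"
      by (simp add: YS scaleC_scaleC)
    moreover have "\<dots> \<longlonglongrightarrow> bop_apply X x + f (f x)"
      by (intro tendsto_add tendsto_const sq)
    ultimately show "bop_apply (2 *\<^sub>C F) x = bop_apply (X + F * F) x"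
      using LIMSEQ_unique by (fastforce simp: F)
  qed
  show ?thesis
  proof
    \<comment> \<open>The fixed-point equation for \<open>F\<close> is
      \<open>(1 - F) * (1 - F) = A * A\<close> in disguise, so \<open>1 - F\<close> is the square
      root sought; it is nonnegative since \<open>F\<close> is a contraction.\<close>
    have "2 *\<^sub>C F = F + F" using bop_scaleC_add_left[of 1 1 F] by simp
    then have "F + F = 1 - A * A + F * F" using F2 by (simp add: X_def)
    then show "(1 - F) * (1 - F) = A * A" by (simp add: algebra_simps)
    show "(1 - F) * T = T * (1 - F)" if "T * A = A * T" for T
    proof -
      have "F * T = T * F"
      proof (rule bop_eqI)
        fix x
        have "(\<lambda>n. bop_apply (Y n) (bop_apply T x)) \<longlonglongrightarrow> f (bop_apply T x)" by (rule f)
        moreover have "(\<lambda>n. bop_apply (Y n) (bop_apply T x)) = (\<lambda>n. bop_apply T (bop_apply (Y n) x))"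
          using commA[OF that] by (metis times_bop.rep_eq)
        moreover have "\<dots> \<longlonglongrightarrow> bop_apply T (f x)"
          by (rule bounded_linear.tendsto[OF bounded_linear_bop_apply f])
        ultimately show "bop_apply (F * T) x = bop_apply (T * F) x"
          using LIMSEQ_unique by (fastforce simp: F)
      qed
      then show ?thesis by (simp add: algebra_simps)
    qed
    show "0 \<le> Re (cinner (bop_apply (1 - F) x) x)" for x
    proof -
      have "Re (cinner (f x) x) \<le> norm x * norm x"
        using Re_cinner_le[of "f x" x] fnorm[of x] by (meson mult_right_mono norm_ge_zero order_trans)
      then show ?thesis by (simp add: F cinner_diff_left cinner_self power2_eq_square)
    qed
  qed
qed

lemma absolute_value_exists:
  assumes adj: "is_adjoint A A"
  obtains S where "S * S = A * A" "\<And>T. T * A = A * T \<Longrightarrow> S * T = T * S"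
    "\<And>x. 0 \<le> Re (cinner (bop_apply S x) x)"
proof -
  obtain r where "r > 0" and r: "\<And>x. norm (bop_apply A x) \<le> norm x * r"
    using bounded_linear.pos_bounded[OF bounded_linear_bop_apply[of A]] by blast
  let ?r = "complex_of_real r" and ?i = "complex_of_real (1 / r)"
  have ri: "?r * ?i = 1" using \<open>r > 0\<close> by (simp flip: of_real_mult)
  obtain S where S: "S * S = (?i *\<^sub>C A) * (?i *\<^sub>C A)" "\<And>T. T * (?i *\<^sub>C A) = (?i *\<^sub>C A) * T \<Longrightarrow> S * T = T * S"
    "\<And>x. 0 \<le> Re (cinner (bop_apply S x) x)"
  proof (rule absolute_value_of_contraction)
    show "is_adjoint (?i *\<^sub>C A) (?i *\<^sub>C A)" using is_adjoint_scaleC[OF adj, of ?i] by simp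
    show "norm (bop_apply (?i *\<^sub>C A) x) \<le> norm x" for x
      using r[of x] \<open>r > 0\<close> by (simp add: norm_scaleC norm_divide divide_le_eq)
  qed blast
  show ?thesis
  proof
    have "(?r * ?r) *\<^sub>C (S * S) = (?r * ?i * (?r * ?i)) *\<^sub>C (A * A)"
      unfolding S(1) by (simp add: mult.assoc mult.left_commute)
    then show "(?r *\<^sub>C S) * (?r *\<^sub>C S) = A * A" unfolding ri by simp
    show "(?r *\<^sub>C S) * T = T * (?r *\<^sub>C S)" if "T * A = A * T" for T
      using S(2)[of T] that by simp
    show "0 \<le> Re (cinner (bop_apply (?r *\<^sub>C S) x) x)" for x
      using S(3)[of x] \<open>r > 0\<close> by (simp add: cinner_scaleC_left)
  qed
qed

text \<open>The real \<open>t\<close> with \<open>A - t q\<close> nonnegative form an initial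
  segment whose supremum is the scalar. Zero divisors are excluded in the double commutant of
  \<open>{A, q}\<close> because the absolute value of \<open>A - t q\<close> lies there, and only
  among elements below \<open>q\<close> so that the lemma covers corners.\<close>

lemma selfadjoint_multiple_if_no_zero_divisors:
  assumes A: "is_adjoint A A" and q: "is_adjoint q q" "q * q = q" and qA: "q * A = A" "A * q = A"
    and nzd: "\<And>U V. U \<in> commutant (commutant {A, q}) \<Longrightarrow> V \<in> commutant (commutant {A, q}) \<Longrightarrow>
      q * U = U \<Longrightarrow> q * V = V \<Longrightarrow> U * V = 0 \<Longrightarrow> U = 0 \<or> V = 0"
  shows "\<exists>t. A = complex_of_real t *\<^sub>C q"
proof (cases "q = 0")
  case True
  then show ?thesis using qA by simp
next
  case False
  let ?N = "\<lambda>x. (norm (bop_apply q x))\<^sup>2"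
  let ?a = "\<lambda>x. Re (cinner (bop_apply A x) x)"
  have qA_apply: "bop_apply q (bop_apply A x) = bop_apply A x" "bop_apply A (bop_apply q x) = bop_apply A x" for x
    using qA by (metis times_bop.rep_eq)+
  have qq: "Re (cinner (bop_apply q x) x) = ?N x" for x
    using is_adjointD[OF q(1), of "bop_apply q x" x] q(2)
    by (metis Re_complex_of_real cinner_self times_bop.rep_eq)
  have dich: "(\<forall>x. t * ?N x \<le> ?a x) \<or> (\<forall>x. ?a x \<le> t * ?N x)" for t
  proof -
    define B where "B = A - complex_of_real t *\<^sub>C q"
    have Badj: "is_adjoint B B"
      unfolding B_def using is_adjoint_diff[OF A is_adjoint_scaleC[OF q(1), of "complex_of_real t"]] by simp
    have qB: "q * B = B" "B * q = B"
      by (simp_all add: B_def qA q(2) right_diff_distrib left_diff_distrib)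
    obtain S where S: "S * S = B * B" "\<And>T. T * B = B * T \<Longrightarrow> S * T = T * S"
      "\<And>x. 0 \<le> Re (cinner (bop_apply S x) x)"
      using absolute_value_exists[OF Badj] by metis
    have S_in: "S \<in> commutant (commutant {A, q})"
    proof -
      have "S * T = T * S" if "T \<in> commutant {A, q}" for T
        using that by (intro S(2)) (auto simp: commutant_def B_def right_diff_distrib left_diff_distrib)
      then show ?thesis by (simp add: commutant_def)
    qed
    have gen: "A \<in> commutant (commutant {A, q})" "q \<in> commutant (commutant {A, q})"
      by (auto simp: commutant_def)
    then have B_in: "B \<in> commutant (commutant {A, q})"
      unfolding B_def by (intro commutant_closed)
    have Sq: "S * q = q * S" and SB: "S * B = B * S" using S(2) qB by auto
    \<comment> \<open>Compressing \<open>S\<close> by \<open>q\<close> brings both factors below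
      \<open>q\<close>, where \<open>nzd\<close> applies. As \<open>S\<close> commutes with
      \<open>q\<close> and \<open>B\<close>, the product is
      \<open>q * B * B - B * B\<close>.\<close>
    have "(q * S - B) * (q * S + B) = 0"
    proof -
      have "q * S * (q * S) = q * (B * B)" by (metis S(1) Sq mult.assoc q(2))
      moreover have "q * S * B = B * (q * S)" by (metis SB mult.assoc qB)
      ultimately show ?thesis
        by (simp add: left_diff_distrib distrib_left flip: mult.assoc) (simp add: mult.assoc qB)
    qed
    moreover have "q * (q * S - B) = q * S - B" "q * (q * S + B) = q * S + B"
      using q(2) qB by (simp_all add: right_diff_distrib distrib_left flip: mult.assoc)
    moreover have "q * S - B \<in> commutant (commutant {A, q})" "q * S + B \<in> commutant (commutant {A, q})"
      by (intro commutant_closed S_in B_in gen)+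
    ultimately have "q * S - B = 0 \<or> q * S + B = 0" by (intro nzd)
    then have "B = q * S \<or> B = - (q * S)" by (auto simp: eq_neg_iff_add_eq_0 add.commute)
    moreover have "0 \<le> Re (cinner (bop_apply (q * S) x) x)" for x
    proof -
      have "q * S = q * (S * q)" unfolding Sq by (simp add: q(2) flip: mult.assoc)
      then have "bop_apply (q * S) x = bop_apply q (bop_apply S (bop_apply q x))" by simp
      then show ?thesis using S(3)[of "bop_apply q x"] by (simp add: is_adjointD[OF q(1)])
    qed
    moreover have "Re (cinner (bop_apply B x) x) = ?a x - t * ?N x" for x
      by (simp add: B_def cinner_diff_left cinner_scaleC_left qq)
    moreover have "Re (cinner (bop_apply (- C) x) x) = - Re (cinner (bop_apply C x) x)" for C :: "'a bop" and x
      by (simp add: cinner_minus_left)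
    ultimately show ?thesis
      by (metis diff_ge_0_iff_ge minus_diff_eq minus_minus)
  qed
  define T where "T = {t. \<forall>x. t * ?N x \<le> ?a x}"
  obtain r where r: "\<And>x. norm (bop_apply A x) \<le> norm x * r"
    using bounded_linear.bounded[OF bounded_linear_bop_apply[of A]] by blast
  \<comment> \<open>A bound by the form of \<open>q\<close>, not by the norm of \<open>x\<close>: it
    makes \<open>T\<close> nonempty and bounded above, and it settles the vectors killed by
    \<open>q\<close>.\<close>
  have abound: "\<bar>?a x\<bar> \<le> r * ?N x" for x
  proof -
    have a: "?a x = Re (cinner (bop_apply A (bop_apply q x)) (bop_apply q x))"
      using is_adjointD[OF q(1), of "bop_apply A x" x] qA_apply by simp
    have "?a x \<le> norm (bop_apply q x) * r * norm (bop_apply q x)"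
      "- ?a x \<le> norm (bop_apply q x) * r * norm (bop_apply q x)"
      unfolding a
      using Re_cinner_le[of "bop_apply A (bop_apply q x)" "bop_apply q x"]
        Re_cinner_le[of "- bop_apply A (bop_apply q x)" "bop_apply q x"]
        mult_right_mono[OF r[of "bop_apply q x"] norm_ge_zero[of "bop_apply q x"]]
      by (auto simp: cinner_minus_left)
    then show ?thesis by (simp add: power2_eq_square mult.commute mult.left_commute abs_le_iff)
  qed
  obtain e where e: "bop_apply q e \<noteq> 0" using False bop_eqI[of q 0] by auto
  then have Ne: "0 < ?N e" by simp
  have T_le: "t \<le> r" if "t \<in> T" for t
  proof -
    have "t * ?N e \<le> ?a e" using that by (simp add: T_def)
    also have "\<dots> \<le> r * ?N e" using abound[of e] by linarith
    finally have "t * ?N e \<le> r * ?N e" .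
    then show ?thesis using Ne mult_le_cancel_right_pos by blast
  qed
  have "- r * ?N x \<le> ?a x" for x using abound[of x] by (simp add: abs_le_iff)
  then have "- r \<in> T" unfolding T_def by blast
  then have bdd: "T \<noteq> {}" "bdd_above T" using T_le by (auto simp: bdd_above_def)
  define s where "s = Sup T"
  have lower: "s * ?N x \<le> ?a x" for x
  proof (cases "?N x = 0")
    case True
    then show ?thesis using abound[of x] by simp
  next
    case False
    then have pos: "0 < ?N x" by simp
    have "s \<le> ?a x / ?N x"
      unfolding s_def using bdd(1) pos by (intro cSup_least) (auto simp: T_def pos_le_divide_eq)
    then show ?thesis using pos by (simp add: pos_le_divide_eq)
  qed
  \<comment> \<open>Every \<open>s + \<delta>\<close> with \<delta> positive lies outside
    \<open>T\<close>, so \<open>dich\<close> gives the reverse inequality there; \<delta> is chosen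
    so that the excess is at most \<epsilon>.\<close>
  have upper: "?a x \<le> s * ?N x" for x
  proof (rule field_le_epsilon)
    fix \<epsilon> :: real assume "\<epsilon> > 0"
    define \<delta> where "\<delta> = \<epsilon> / (?N x + 1)"
    have p: "?N x + 1 > 0" by (simp add: add_nonneg_pos)
    then have "\<delta> > 0" using \<open>\<epsilon> > 0\<close> by (simp add: \<delta>_def)
    then have "s + \<delta> \<notin> T" using cSup_upper[OF _ bdd(2), of "s + \<delta>"] by (auto simp: s_def)
    then have "?a x \<le> (s + \<delta>) * ?N x" using dich[of "s + \<delta>"] by (auto simp: T_def)
    also have "\<dots> = s * ?N x + \<delta> * ?N x" by (simp add: distrib_right)
    also have "\<delta> * ?N x \<le> \<epsilon>" using p \<open>\<epsilon> > 0\<close> by (simp add: \<delta>_def field_simps)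
    finally show "?a x \<le> s * ?N x + \<epsilon>" by simp
  qed
  have "A - complex_of_real s *\<^sub>C q = 0"
  proof (rule selfadjoint_eq_0)
    show "is_adjoint (A - complex_of_real s *\<^sub>C q) (A - complex_of_real s *\<^sub>C q)"
      using is_adjoint_diff[OF A is_adjoint_scaleC[OF q(1), of "complex_of_real s"]] by simp
    show "Re (cinner (bop_apply (A - complex_of_real s *\<^sub>C q) x) x) = 0" for x
      using lower[of x] upper[of x] by (simp add: cinner_diff_left cinner_scaleC_left qq)
  qed
  then show ?thesis by (intro exI[of _ s]) simp
qed

text \<open>Intended for \<open>Z'\<close> the adjoint of \<open>Z\<close>, when both combinations
  are self-adjoint: the Cartesian decomposition of \<open>Z\<close>.\<close>

lemma multiple_if_real_and_imaginary_part:
  fixes Z Z' :: "'h::complex_hilbert bop"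
  assumes "Z + Z' = s *\<^sub>C q" "\<i> *\<^sub>C (Z - Z') = t *\<^sub>C q"
  shows "\<exists>c. Z = c *\<^sub>C q"
proof -
  have "Z + Z = (Z + Z') - \<i> *\<^sub>C \<i> *\<^sub>C (Z - Z')" by (simp add: bop_scaleC_minus_left)
  also have "\<dots> = (s - \<i> * t) *\<^sub>C q" unfolding assms by (simp add: bop_scaleC_diff_left)
  finally have "(1/2) *\<^sub>C (Z + Z) = (1/2) *\<^sub>C (s - \<i> * t) *\<^sub>C q" by simp
  moreover have "(1/2) *\<^sub>C (Z + Z) = Z"
    using bop_scaleC_add_left[of "1/2" "1/2" Z] by (simp add: bop_scaleC_add_right)
  ultimately show ?thesis by auto
qed

section \<open>Factors\<close>

lemma factor_von_neumann: "factor M \<Longrightarrow> von_neumann_algebra M"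
  by (simp add: factor_def)

lemma factor_centralE:
  assumes "factor M" "Z \<in> M" "\<And>A. A \<in> M \<Longrightarrow> Z * A = A * Z"
  obtains c where "Z = c *\<^sub>C 1"
  using assms unfolding factor_def center_def scalar_ops_def by blast

lemma factor_adjointE:
  assumes "factor M" "A \<in> M"
  obtains B where "B \<in> M" "is_adjoint A B" "is_adjoint B A"
  using assms unfolding factor_def von_neumann_algebra_def by (metis is_adjoint_commute)

text \<open>The closed span of the ranges of all \<open>X * B\<close> is invariant under
  \<open>M\<close>, so its projection \<open>P\<close> satisfies \<open>X * P = P * X * P\<close>.
  Taking adjoints makes \<open>P\<close> central, hence a scalar: if it is 0 then
  \<open>B = 0\<close>, otherwise \<open>A * P = 0\<close> gives \<open>A = 0\<close>.\<close>

lemma factor_prime: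
  assumes M: "factor M" and AB: "A \<in> M" "B \<in> M" and AMB: "\<And>X. X \<in> M \<Longrightarrow> A * X * B = 0"
  shows "A = 0 \<or> B = 0"
proof -
  note vN = factor_von_neumann[OF M]
  have S: "(\<lambda>X. X * B) ` M \<subseteq> M" using von_neumann_closed[OF vN] AB by auto
  obtain P where P: "P \<in> M" "is_adjoint P P" "P * P = P" "\<And>X. X \<in> M \<Longrightarrow> P * (X * B) = X * B"
    "\<And>E. (\<And>X. X \<in> M \<Longrightarrow> E * (X * B) = 0) \<Longrightarrow> E * P = 0"
    by (rule von_neumann_range_projection[OF vN S]) blast
  have PX: "X * P = P * X * P" if "X \<in> M" for X
  proof -
    have "((1 - P) * X) * (Y * B) = 0" if "Y \<in> M" for Y
      using P(4)[of "X * Y"] von_neumann_closed(5)[OF vN \<open>X \<in> M\<close> that]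
      by (simp add: left_diff_distrib mult.assoc)
    then have "(1 - P) * X * P = 0" by (rule P(5))
    then show ?thesis by (simp add: left_diff_distrib)
  qed
  have "P * X = X * P" if "X \<in> M" for X
  proof -
    obtain X' where X': "X' \<in> M" "is_adjoint X X'" "is_adjoint X' X" using factor_adjointE[OF M \<open>X \<in> M\<close>] by metis
    have "is_adjoint (X' * P) (P * X)" using is_adjoint_mult[OF X'(3) P(2)] .
    moreover have "is_adjoint (P * X' * P) (P * (X * P))"
      using is_adjoint_mult[OF is_adjoint_mult[OF P(2) X'(3)] P(2)] by (simp add: mult.assoc)
    ultimately have "P * X = P * X * P"
      using is_adjoint_unique PX[OF X'(1)] by (metis mult.assoc)
    then show ?thesis using PX[OF that] by simp
  qed
  then obtain c where c: "P = c *\<^sub>C 1" using factor_centralE[OF M P(1)] by metis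
  show ?thesis
  proof (cases "c = 0")
    case True
    then have "B = 0" using P(4)[of 1] c von_neumann_closed(2)[OF vN] by simp
    then show ?thesis ..
  next
    case False
    have "A * P = 0" by (rule P(5)) (use AMB in \<open>simp add: mult.assoc\<close>)
    then have "A = 0" using False c by simp
    then show ?thesis ..
  qed
qed

text \<open>For \<open>A\<close> self-adjoint and central in the corner, \<open>{A, q}\<close>
  commutes with \<open>q * M * q\<close>, hence so does its double commutant. If
  \<open>U * V = 0\<close> there, then \<open>U * X * V = (q * X * q) * U * V = 0\<close> for all
  \<open>X\<close>, and primeness excludes zero divisors.\<close>

lemma factor_corner_center:
  assumes M: "factor M" and q: "q \<in> M" "is_adjoint q q" "q * q = q"
    and Z: "Z \<in> M" "q * Z = Z" "Z * q = Z" "\<And>X. X \<in> M \<Longrightarrow> Z * (q * X * q) = (q * X * q) * Z"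
  shows "\<exists>c. Z = c *\<^sub>C q"
proof -
  note vN = factor_von_neumann[OF M]
  have real: "\<exists>t. A = complex_of_real t *\<^sub>C q"
    if A: "A \<in> M" "is_adjoint A A" "q * A = A" "A * q = A"
      and comm: "\<And>X. X \<in> M \<Longrightarrow> A * (q * X * q) = (q * X * q) * A" for A
  proof (rule selfadjoint_multiple_if_no_zero_divisors[OF A(2) q(2,3) A(3,4)])
    fix U V assume UV: "U \<in> commutant (commutant {A, q})" "V \<in> commutant (commutant {A, q})"
      "q * U = U" "q * V = V" "U * V = 0"
    have UM: "U \<in> M" "V \<in> M" using UV von_neumann_bicommutant[OF vN, of "{A, q}"] A(1) q(1) by auto
    have "q \<in> commutant {A, q}" using A by (auto simp: commutant_def)
    then have "U * q = U" using UV(1,3) by (simp add: commutant_def)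
    have "U * X * V = 0" if "X \<in> M" for X
    proof -
      have "q * (q * X * q) = q * X * q" "(q * X * q) * q = q * X * q"
        by (metis mult.assoc q(3))+
      then have "q * X * q \<in> commutant {A, q}" using comm[OF that] by (simp add: commutant_def)
      then have "U * (q * X * q) = (q * X * q) * U" using UV(1) by (simp add: commutant_def)
      moreover have "U * X * V = U * (q * X * q) * V"
      proof -
        have "U * (q * X * q) * V = (U * q) * X * (q * V)" by (simp only: mult.assoc)
        then show ?thesis unfolding \<open>U * q = U\<close> UV(4) by simp
      qed
      ultimately have "U * X * V = q * X * q * (U * V)" by (simp only: mult.assoc)
      then show ?thesis using UV(5) by simp
    qed
    then show "U = 0 \<or> V = 0" using factor_prime[OF M UM] by blast
  qed
  obtain Z' where Z': "Z' \<in> M" "is_adjoint Z Z'" "is_adjoint Z' Z" using factor_adjointE[OF M Z(1)] by metis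
  have "is_adjoint Z (q * Z')" "is_adjoint Z (Z' * q)"
    using is_adjoint_mult[OF Z'(2) q(2)] is_adjoint_mult[OF q(2) Z'(2)] by (simp_all add: Z(2,3))
  then have qZ': "q * Z' = Z'" "Z' * q = Z'"
    using is_adjoint_unique[OF _ Z'(2)] by blast+
  have comm': "Z' * (q * X * q) = (q * X * q) * Z'" if X: "X \<in> M" for X
  proof -
    obtain X' where X': "X' \<in> M" "is_adjoint X X'" "is_adjoint X' X" using factor_adjointE[OF M X] by metis
    have a: "is_adjoint (q * X' * q) (q * X * q)"
      using is_adjoint_mult[OF is_adjoint_mult[OF q(2) X'(3)] q(2)] by (simp add: mult.assoc)
    show ?thesis
      by (rule is_adjoint_unique[OF is_adjoint_mult[OF a Z'(2)]])
        (use is_adjoint_mult[OF Z'(2) a] Z(4)[OF X'(1)] in simp)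
  qed
  have "is_adjoint (Z + Z') (Z + Z')"
    using is_adjoint_add[OF Z'(2,3)] by (simp add: add.commute)
  then have "\<exists>t. Z + Z' = complex_of_real t *\<^sub>C q"
    by (intro real) (use Z Z' qZ' comm' von_neumann_closed[OF vN] in \<open>simp_all add: distrib_left distrib_right\<close>)
  moreover have "is_adjoint (\<i> *\<^sub>C (Z - Z')) (\<i> *\<^sub>C (Z - Z'))"
    using is_adjoint_scaleC[OF is_adjoint_diff[OF Z'(2,3)], of \<i>]
    by (simp add: bop_scaleC_minus_left bop_scaleC_diff_right)
  then have "\<exists>t. \<i> *\<^sub>C (Z - Z') = complex_of_real t *\<^sub>C q"
    by (intro real)
      (use Z Z' qZ' comm' von_neumann_closed[OF vN] in \<open>simp_all add: left_diff_distrib right_diff_distrib\<close>)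
  ultimately show ?thesis using multiple_if_real_and_imaginary_part by blast
qed

text \<open>If \<open>U * V = 0\<close>, then \<open>U\<close> annihilates the range projection of
  \<open>V\<close>. Were all projections 0 or 1, this would exclude zero divisors and make every
  self-adjoint element a scalar.\<close>

lemma factor_nontrivial_projection:
  assumes M: "factor M" and "M \<noteq> scalar_ops"
  obtains P where "P \<in> M" "is_adjoint P P" "P * P = P" "P \<noteq> 0" "P \<noteq> 1"
proof (rule ccontr)
  assume no: "\<not> thesis"
  note nontrivial = that
  note vN = factor_von_neumann[OF M]
  have nzd: "U = 0 \<or> V = 0" if UV: "U \<in> M" "V \<in> M" "U * V = 0" for U V
  proof -
    obtain P where P: "P \<in> M" "is_adjoint P P" "P * P = P" "P * V = V" "U * P = 0"
      by (rule von_neumann_range_projection[OF vN, of "{V}"]) (use UV in auto)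
    then have "P = 0 \<or> P = 1" using no nontrivial by blast
    then show ?thesis using P(4,5) by auto
  qed
  have real: "\<exists>t. A = complex_of_real t *\<^sub>C 1" if "A \<in> M" "is_adjoint A A" for A
  proof (rule selfadjoint_multiple_if_no_zero_divisors)
    fix U V assume "U \<in> commutant (commutant {A, 1})" "V \<in> commutant (commutant {A, 1})" "U * V = 0"
    then show "U = 0 \<or> V = 0"
      using nzd von_neumann_bicommutant[OF vN, of "{A, 1}"] von_neumann_closed(2)[OF vN] \<open>A \<in> M\<close> by blast
  qed (use that in \<open>simp_all add: is_adjoint_one\<close>)
  have "Z \<in> scalar_ops" if Z: "Z \<in> M" for Z
  proof -
    obtain Z' where Z': "Z' \<in> M" "is_adjoint Z Z'" "is_adjoint Z' Z" using factor_adjointE[OF M Z] by metis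
    have "is_adjoint (Z + Z') (Z + Z')"
      using is_adjoint_add[OF Z'(2,3)] by (simp add: add.commute)
    then have "\<exists>t. Z + Z' = complex_of_real t *\<^sub>C 1"
      by (intro real von_neumann_closed[OF vN] Z Z'(1))
    moreover have "is_adjoint (\<i> *\<^sub>C (Z - Z')) (\<i> *\<^sub>C (Z - Z'))"
      using is_adjoint_scaleC[OF is_adjoint_diff[OF Z'(2,3)], of \<i>]
      by (simp add: bop_scaleC_minus_left bop_scaleC_diff_right)
    then have "\<exists>t. \<i> *\<^sub>C (Z - Z') = complex_of_real t *\<^sub>C 1"
      by (intro real von_neumann_closed[OF vN] Z Z'(1))
    ultimately show ?thesis using multiple_if_real_and_imaginary_part unfolding scalar_ops_def by blast
  qed
  moreover have "scalar_ops \<subseteq> M" using M unfolding factor_def center_def by blast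
  ultimately show False using assms(2) by blast
qed

section \<open>Jordan derivations of prime rings\<close>

text \<open>Carried by a set instead of a type because a factor is a set of operators;
  \<open>torsion_free\<close> concerns 2-torsion.\<close>

locale prime_subring =
  fixes R :: "'a::{ring, monoid_mult} set"
  assumes zero_closed [simp]: "0 \<in> R" and one_closed [simp]: "1 \<in> R"
    and add_closed [simp]: "a \<in> R \<Longrightarrow> b \<in> R \<Longrightarrow> a + b \<in> R"
    and diff_closed [simp]: "a \<in> R \<Longrightarrow> b \<in> R \<Longrightarrow> a - b \<in> R"
    and mult_closed [simp]: "a \<in> R \<Longrightarrow> b \<in> R \<Longrightarrow> a * b \<in> R"
    and prime: "a \<in> R \<Longrightarrow> b \<in> R \<Longrightarrow> (\<And>x. x \<in> R \<Longrightarrow> a * x * b = 0) \<Longrightarrow> a = 0 \<or> b = 0"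
    and torsion_free: "a \<in> R \<Longrightarrow> a + a = 0 \<Longrightarrow> a = 0"
begin

lemma double_cancel: "a \<in> R \<Longrightarrow> b \<in> R \<Longrightarrow> a + a = b + b \<Longrightarrow> a = b"
  using torsion_free[of "a - b"] by (simp add: algebra_simps)

definition ring_center where "ring_center = {z \<in> R. \<forall>x\<in>R. z * x = x * z}"

lemma ring_center_closed: "z \<in> ring_center \<Longrightarrow> z \<in> R"
  by (simp add: ring_center_def)

lemma ring_center_commute: "z \<in> ring_center \<Longrightarrow> x \<in> R \<Longrightarrow> z * x = x * z"
  by (simp add: ring_center_def)

lemma ring_center_intros: "0 \<in> ring_center" "z \<in> ring_center \<Longrightarrow> w \<in> ring_center \<Longrightarrow> z + w \<in> ring_center" "z \<in> ring_center \<Longrightarrow> w \<in> ring_center \<Longrightarrow> z - w \<in> ring_center"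
  by (auto simp: ring_center_def algebra_simps)

lemma ring_center_mult_eq_0:
  assumes "z \<in> ring_center" "x \<in> R" "z * x = 0"
  shows "z = 0 \<or> x = 0"
proof (rule prime)
  show "z * y * x = 0" if "y \<in> R" for y
    using assms ring_center_commute[OF assms(1) that] by (metis mult.assoc mult_zero_right)
qed (use assms ring_center_closed in auto)

text \<open>Rewriting \<open>w = a x b y a x b\<close> to \<open>b x b y a x a\<close> takes one
  exchange of \<open>a\<close> and \<open>b\<close> along one route and four along another. The
  signs differ, so \<open>w = - w\<close> and \<open>a x b\<close> vanishes by primeness.\<close>

lemma symmetric_prime:
  assumes ab: "a \<in> R" "b \<in> R" and anti: "\<And>x. x \<in> R \<Longrightarrow> a * x * b = - (b * x * a)"
  shows "a = 0 \<or> b = 0"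
proof (rule prime[OF ab])
  fix x assume x: "x \<in> R"
  have "a * x * b * y * (a * x * b) = 0" if y: "y \<in> R" for y
  proof -
    define w where "w = a * x * b * y * (a * x * b)"
    have "w = a * (x * b * y * a * x) * b" by (simp add: w_def mult.assoc)
    also have "\<dots> = - (b * (x * b * y * a * x) * a)" using ab x y by (intro anti) simp
    finally have 1: "w = - (b * x * b * y * a * x * a)" by (simp add: mult.assoc)
    have "w = a * x * (b * y * a) * (x * b)" by (simp add: w_def mult.assoc)
    also have "b * y * a = - (a * y * b)" using anti[OF y] by simp
    also have "a * x * - (a * y * b) * (x * b) = - (a * (x * a * y) * b * x * b)" by (simp add: mult.assoc)
    also have "a * (x * a * y) * b = - (b * (x * a * y) * a)" using ab x y by (intro anti) simp
    also have "- (- (b * (x * a * y) * a) * x * b) = b * x * a * y * (a * x * b)" by (simp add: mult.assoc)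
    also have "a * x * b = - (b * x * a)" by (rule anti[OF x])
    also have "b * x * a * y * - (b * x * a) = - (b * x * (a * y * b) * x * a)" by (simp add: mult.assoc)
    also have "a * y * b = - (b * y * a)" by (rule anti[OF y])
    also have "- (b * x * - (b * y * a) * x * a) = b * x * b * y * a * x * a" by (simp add: mult.assoc)
    finally have 2: "w = b * x * b * y * a * x * a" .
    have "w + w = 0" by (subst (2) 2, subst 1) simp
    then show ?thesis using torsion_free[of w] ab x y by (simp add: w_def)
  qed
  then show "a * x * b = 0"
    using prime[of "a * x * b" "a * x * b"] ab x by auto
qed

text \<open>A group is not the union of two proper subgroups. It turns a dichotomy for each element
  into one for the whole ring.\<close>

lemma additive_Un:
  assumes "\<And>x. x \<in> R \<Longrightarrow> P x \<or> Q x"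
    and "\<And>x y. x \<in> R \<Longrightarrow> y \<in> R \<Longrightarrow> P (x + y) \<Longrightarrow> P x \<Longrightarrow> P y"
    and "\<And>x y. x \<in> R \<Longrightarrow> y \<in> R \<Longrightarrow> Q (x + y) \<Longrightarrow> Q x \<Longrightarrow> Q y"
  shows "(\<forall>x\<in>R. P x) \<or> (\<forall>x\<in>R. Q x)"
proof (rule ccontr)
  assume "\<not> ?thesis"
  then obtain x y where xy: "x \<in> R" "\<not> P x" "y \<in> R" "\<not> Q y" by blast
  then have "P y" "Q x" using assms(1) by auto
  then show False
    using assms(1)[of "y + x"] assms(2)[of y x] assms(3)[of x y] xy by (auto simp: add.commute)
qed

text \<open>The defect \<delta> is tested against commutators: \<open>a b x b a + b a x a b\<close>
  is a sum of expressions \<open>u v u\<close> and also an instance of \<open>u v w + w v u\<close>.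
  Evaluating \<open>J\<close> both ways leaves an identity between \<open>\<delta> a b\<close> and
  \<open>a * b - b * a\<close> to which \<open>symmetric_prime\<close> applies.\<close>

theorem Jordan_derivation_is_derivation:
  assumes J_closed: "\<And>a. a \<in> R \<Longrightarrow> J a \<in> R"
    and J_add: "\<And>a b. a \<in> R \<Longrightarrow> b \<in> R \<Longrightarrow> J (a + b) = J a + J b"
    and J_Jordan: "\<And>a b. a \<in> R \<Longrightarrow> b \<in> R \<Longrightarrow> J (a * b + b * a) = J a * b + b * J a + (a * J b + J b * a)"
  shows "(\<forall>a\<in>R. \<forall>b\<in>R. J (a * b) = J a * b + a * J b) \<or> (\<forall>a\<in>R. \<forall>b\<in>R. a * b = b * a)"
proof -
  have J_sq: "J (a * a) = J a * a + a * J a" if "a \<in> R" for a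
  proof (rule double_cancel)
    have "J (a * a) + J (a * a) = J (a * a + a * a)" using that by (simp add: J_add)
    also have "\<dots> = (J a * a + a * J a) + (J a * a + a * J a)"
      unfolding J_Jordan[OF that that] by (simp only: add_ac)
    finally show "J (a * a) + J (a * a) = (J a * a + a * J a) + (J a * a + a * J a)" .
  qed (use that J_closed in simp_all)
  have J3: "J (a * b * a) = J a * b * a + a * J b * a + a * b * J a" if "a \<in> R" "b \<in> R" for a b
  proof (rule double_cancel)
    let ?c = "a * b + b * a"
    \<comment> \<open>Iterating the Jordan product with \<open>a\<close> isolates
      \<open>a * b * a\<close>, up to a factor 2.\<close>
    have "a * ?c + ?c * a = (a * a * b + b * (a * a)) + (a * b * a + a * b * a)"
      by (simp add: algebra_simps)
    then have "J (a * ?c + ?c * a) = J (a * a * b + b * (a * a)) + (J (a * b * a) + J (a * b * a))"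
      using that by (simp add: J_add)
    then have "J (a * b * a) + J (a * b * a) = J (a * ?c + ?c * a) - J (a * a * b + b * (a * a))"
      by simp
    also have "\<dots> = (J a * ?c + ?c * J a + (a * J ?c + J ?c * a))
        - (J (a * a) * b + b * J (a * a) + (a * a * J b + J b * (a * a)))"
      using that by (simp only: J_Jordan add_closed mult_closed)
    also have "\<dots> = (J a * b * a + a * J b * a + a * b * J a) + (J a * b * a + a * J b * a + a * b * J a)"
      using that by (simp only: J_Jordan J_sq) (simp add: algebra_simps)
    finally show "J (a * b * a) + J (a * b * a)
        = (J a * b * a + a * J b * a + a * b * J a) + (J a * b * a + a * J b * a + a * b * J a)" .
  qed (use that J_closed in simp_all)
  have J_lin: "J (a * b * c + c * b * a)
      = (J a * b * c + a * J b * c + a * b * J c) + (J c * b * a + c * J b * a + c * b * J a)"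
    if "a \<in> R" "b \<in> R" "c \<in> R" for a b c
  proof -
    have "(a + c) * b * (a + c) = (a * b * a + c * b * c) + (a * b * c + c * b * a)"
      by (simp add: algebra_simps)
    then have "J ((a + c) * b * (a + c)) = (J (a * b * a) + J (c * b * c)) + J (a * b * c + c * b * a)"
      using that by (simp add: J_add)
    then have "J (a * b * c + c * b * a) = J ((a + c) * b * (a + c)) - (J (a * b * a) + J (c * b * c))"
      by simp
    also have "\<dots> = (J a * b * c + a * J b * c + a * b * J c) + (J c * b * a + c * J b * a + c * b * J a)"
      using that by (simp only: J3 J_add add_closed) (simp add: algebra_simps)
    finally show ?thesis .
  qed
  define \<delta> where "\<delta> a b = J (a * b) - J a * b - a * J b" for a b
  have \<delta>_anti: "J (b * a) = J b * a + b * J a - \<delta> a b" if "a \<in> R" "b \<in> R" for a b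
  proof -
    have "J (b * a) = J (a * b + b * a) - J (a * b)" using that by (simp add: J_add)
    then show ?thesis unfolding J_Jordan[OF that] by (simp add: \<delta>_def algebra_simps)
  qed
  have \<delta>_J: "J (a * b) = J a * b + a * J b + \<delta> a b" for a b
    by (simp add: \<delta>_def)
  have \<delta>_closed: "\<delta> a b \<in> R" if "a \<in> R" "b \<in> R" for a b
    using that J_closed by (simp add: \<delta>_def)
  have key: "\<delta> a b = 0 \<or> a * b - b * a = 0" if ab: "a \<in> R" "b \<in> R" for a b
  proof (rule symmetric_prime)
    fix x assume x: "x \<in> R"
    have "J ((a * b) * x * (b * a) + (b * a) * x * (a * b))
        = J (a * (b * x * b) * a) + J (b * (a * x * a) * b)"
      using ab x by (subst J_add[symmetric]) (simp_all add: mult.assoc)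
    also have "\<dots> = (J a * (b * x * b) * a + a * (J b * x * b + b * J x * b + b * x * J b) * a + a * (b * x * b) * J a)
        + (J b * (a * x * a) * b + b * (J a * x * a + a * J x * a + a * x * J a) * b + b * (a * x * a) * J b)"
      using ab x by (simp only: J3 mult_closed)
    finally have eq: "(J (a * b) * x * (b * a) + (a * b) * J x * (b * a) + (a * b) * x * J (b * a))
        + (J (b * a) * x * (a * b) + (b * a) * J x * (a * b) + (b * a) * x * J (a * b))
      = (J a * (b * x * b) * a + a * (J b * x * b + b * J x * b + b * x * J b) * a + a * (b * x * b) * J a)
        + (J b * (a * x * a) * b + b * (J a * x * a + a * J x * a + a * x * J a) * b + b * (a * x * a) * J b)"
      using ab x by (simp only: J_lin mult_closed)
    have "\<delta> a b * x * (a * b - b * a) + (a * b - b * a) * x * \<delta> a b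
      = (J a * (b * x * b) * a + a * (J b * x * b + b * J x * b + b * x * J b) * a + a * (b * x * b) * J a)
        + (J b * (a * x * a) * b + b * (J a * x * a + a * J x * a + a * x * J a) * b + b * (a * x * a) * J b)
      - ((J (a * b) * x * (b * a) + (a * b) * J x * (b * a) + (a * b) * x * J (b * a))
        + (J (b * a) * x * (a * b) + (b * a) * J x * (a * b) + (b * a) * x * J (a * b)))"
      unfolding \<delta>_anti[OF ab] \<delta>_J[of a b] by (simp add: algebra_simps)
    then show "\<delta> a b * x * (a * b - b * a) = - ((a * b - b * a) * x * \<delta> a b)"
      unfolding eq by (simp add: eq_neg_iff_add_eq_0)
  qed (use ab \<delta>_closed in simp_all)
  have \<delta>_add: "\<delta> (a + c) b = \<delta> a b + \<delta> c b" "\<delta> b (a + c) = \<delta> b a + \<delta> b c"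
    if "a \<in> R" "b \<in> R" "c \<in> R" for a b c
    using that by (simp_all add: \<delta>_def J_add distrib_left distrib_right)
  \<comment> \<open>\<open>additive_Un\<close> is used once in \<open>b\<close> for fixed
    \<open>a\<close>, then once in \<open>a\<close>.\<close>
  have "(\<forall>b\<in>R. \<delta> a b = 0) \<or> (\<forall>b\<in>R. a * b - b * a = 0)" if "a \<in> R" for a
    using key that by (intro additive_Un) (auto simp: \<delta>_add algebra_simps)
  then have "(\<forall>a\<in>R. \<forall>b\<in>R. \<delta> a b = 0) \<or> (\<forall>a\<in>R. \<forall>b\<in>R. a * b - b * a = 0)"
    by (intro additive_Un) (auto simp: \<delta>_add algebra_simps)
  then show ?thesis by (auto simp: \<delta>_J)
qed

text \<open>With \<open>z\<close> the commutator of \<open>a\<close> and \<open>b\<close>, the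
  commutator of \<open>a\<close> and \<open>a * b\<close> is \<open>a * z\<close>. Its commuting
  with \<open>b\<close> gives \<open>z * z = 0\<close>, and a central element of square 0 in a prime
  ring is 0.\<close>

lemma commutative_if_commutators_central:
  assumes "\<And>a b. a \<in> R \<Longrightarrow> b \<in> R \<Longrightarrow> a * b - b * a \<in> ring_center" and ab: "a \<in> R" "b \<in> R"
  shows "a * b = b * a"
proof -
  define z where "z = a * b - b * a"
  have zZ: "z \<in> ring_center" using assms by (simp add: z_def)
  have zR: "z \<in> R" using zZ by (rule ring_center_closed)
  have "a * (a * b) - (a * b) * a = a * z" by (simp add: z_def right_diff_distrib mult.assoc)
  then have "a * z \<in> ring_center" using assms(1)[of a "a * b"] ab by simp
  then have "a * z * b = b * (a * z)" using ab by (simp add: ring_center_commute)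
  then have "z * (a * b) = z * (b * a)"
    using ring_center_commute[OF zZ, of a] ring_center_commute[OF zZ, of b] ab by (metis mult.assoc)
  then have "z * z = 0" by (simp add: z_def right_diff_distrib)
  then have "z = 0" using ring_center_mult_eq_0[OF zZ zR] by blast
  then show ?thesis by (simp add: z_def)
qed

end

section \<open>Lie derivations of prime rings with a nontrivial idempotent\<close>

text \<open>With indices in \<open>bool\<close>, \<open>\<not> i\<close> names the complementary
  idempotent, and each lemma serves both choices of \<open>i\<close> at once.\<close>

locale peirce_decomposition = prime_subring R for R :: "'a::{ring, monoid_mult} set" +
  fixes e :: "bool \<Rightarrow> 'a"
  assumes e_closed [simp]: "e i \<in> R"
    and e_idem [simp]: "e i * e i = e i"
    and e_sum: "e i + e (\<not> i) = 1"
    and e_nonzero: "e i \<noteq> 0"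
    and corner_center: "z \<in> R \<Longrightarrow> e i * z = z \<Longrightarrow> z * e i = z \<Longrightarrow>
      (\<And>x. x \<in> R \<Longrightarrow> z * (e i * x * e i) = (e i * x * e i) * z) \<Longrightarrow> \<exists>c\<in>ring_center. z = c * e i"
begin

lemma e_orth [simp]: "i \<noteq> j \<Longrightarrow> e i * e j = 0"
proof -
  have "e i * e (\<not> i) = e i * (e i + e (\<not> i)) - e i * e i" by (simp add: distrib_left del: e_idem)
  then have "e i * e (\<not> i) = 0" unfolding e_sum by simp
  then show "i \<noteq> j \<Longrightarrow> e i * e j = 0" by (cases i; cases j) auto
qed

lemma e_idem_assoc [simp]: "e i * (e i * x) = e i * x"
  by (simp flip: mult.assoc)

lemma e_orth_assoc [simp]: "i \<noteq> j \<Longrightarrow> e i * (e j * x) = 0"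
  by (simp flip: mult.assoc)

definition peirce :: "bool \<Rightarrow> bool \<Rightarrow> 'a set"
  where "peirce i j = {x \<in> R. e i * x = x \<and> x * e j = x}"

lemma peirceD: "x \<in> peirce i j \<Longrightarrow> x \<in> R" "x \<in> peirce i j \<Longrightarrow> e i * x = x" "x \<in> peirce i j \<Longrightarrow> x * e j = x"
  by (simp_all add: peirce_def)

lemma peirce_add: "x \<in> peirce i j \<Longrightarrow> y \<in> peirce i j \<Longrightarrow> x + y \<in> peirce i j"
  by (simp add: peirce_def algebra_simps)

lemma peirce_diff: "x \<in> peirce i j \<Longrightarrow> y \<in> peirce i j \<Longrightarrow> x - y \<in> peirce i j"
  by (simp add: peirce_def algebra_simps)

lemma peirce_mult: "x \<in> peirce i j \<Longrightarrow> y \<in> peirce j k \<Longrightarrow> x * y \<in> peirce i k"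
  unfolding peirce_def by (simp add: mult.assoc) (metis mult.assoc)

lemma peirce_corner [simp]: "x \<in> R \<Longrightarrow> e i * x * e j \<in> peirce i j"
  by (simp add: peirce_def mult.assoc)

lemma peirce_mult_0: "x \<in> peirce i j \<Longrightarrow> y \<in> peirce k l \<Longrightarrow> j \<noteq> k \<Longrightarrow> x * y = 0"
  by (metis peirceD(2,3) e_orth mult.assoc mult_zero_left mult_zero_right)

lemma peirce_disjoint: "x \<in> peirce i j \<Longrightarrow> x \<in> peirce k l \<Longrightarrow> i \<noteq> k \<Longrightarrow> x = 0"
  by (metis peirceD(2) e_orth_assoc)

lemma peirce_e_left_0: "x \<in> peirce i j \<Longrightarrow> i \<noteq> k \<Longrightarrow> e k * x = 0"
  by (metis peirceD(2) e_orth_assoc)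

lemma peirce_e_right_0: "x \<in> peirce i j \<Longrightarrow> j \<noteq> k \<Longrightarrow> x * e k = 0"
  by (metis peirceD(3) e_orth mult.assoc mult_zero_right)

lemma decompose: "x = (e i * x * e i + e i * x * e (\<not> i)) + (e (\<not> i) * x * e i + e (\<not> i) * x * e (\<not> i))"
proof -
  have "x = (e i + e (\<not> i)) * x * (e i + e (\<not> i))" unfolding e_sum by simp
  then show ?thesis by (simp add: distrib_left distrib_right add_ac)
qed

text \<open>Primeness in the form used for corners: an identity in one corner may be checked after
  multiplying by all elements of an adjacent one.\<close>

lemma faithful_left:
  assumes "x \<in> peirce i j" "\<And>m. m \<in> peirce j k \<Longrightarrow> x * m = 0"
  shows "x = 0"
proof -
  have "x * y * e k = 0" if "y \<in> R" for y
    using assms(2)[OF peirce_corner[OF that]] peirceD(3)[OF assms(1)] by (simp flip: mult.assoc)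
  then show ?thesis using prime[of x "e k"] peirceD(1)[OF assms(1)] e_nonzero by auto
qed

lemma faithful_right:
  assumes "x \<in> peirce j k" "\<And>m. m \<in> peirce i j \<Longrightarrow> m * x = 0"
  shows "x = 0"
proof -
  have "e i * y * x = 0" if "y \<in> R" for y
    using assms(2)[OF peirce_corner[OF that]] peirceD(2)[OF assms(1)] by (simp add: mult.assoc)
  then show ?thesis using prime[of "e i" x] peirceD(1)[OF assms(1)] e_nonzero by auto
qed

lemma additive_eq_0:
  assumes "\<And>x y. x \<in> R \<Longrightarrow> y \<in> R \<Longrightarrow> f (x + y) = f x + f y"
    and "\<And>x i j. x \<in> peirce i j \<Longrightarrow> f x = (0 :: 'a)" and "x \<in> R"
  shows "f x = 0"
  by (subst decompose[of x True]) (simp add: assms(1,3) assms(2)[OF peirce_corner])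

text \<open>The relation on a single off-diagonal corner propagates to the other three: multiplying
  by \<open>m\<close> and cancelling it by faithfulness gives \<open>c1\<close>, \<open>c2\<close>
  and then \<open>c3\<close>.\<close>

lemma central_if_intertwining:
  assumes x: "x \<in> peirce i i" and y: "y \<in> peirce j j" and ij: "i \<noteq> j"
    and tw: "\<And>m. m \<in> peirce i j \<Longrightarrow> x * m = m * y"
  shows "x + y \<in> ring_center"
proof -
  note xy = peirceD[OF x] peirceD[OF y]
  have c1: "x * a = a * x" if a: "a \<in> peirce i i" for a
  proof -
    have "x * a - a * x = 0"
    proof (rule faithful_left)
      show "x * a - a * x \<in> peirce i i" using a x by (intro peirce_diff peirce_mult)
      show "(x * a - a * x) * m = 0" if m: "m \<in> peirce i j" for m
        using tw[OF m] tw[OF peirce_mult[OF a m]] by (simp add: left_diff_distrib mult.assoc)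
    qed
    then show ?thesis by simp
  qed
  have c2: "y * b = b * y" if b: "b \<in> peirce j j" for b
  proof -
    have "y * b - b * y = 0"
    proof (rule faithful_right)
      show "y * b - b * y \<in> peirce j j" using b y by (intro peirce_diff peirce_mult)
      show "m * (y * b - b * y) = 0" if m: "m \<in> peirce i j" for m
        using tw[OF m] tw[OF peirce_mult[OF m b]] by (simp add: right_diff_distrib flip: mult.assoc)
    qed
    then show ?thesis by simp
  qed
  have c3: "y * n = n * x" if n: "n \<in> peirce j i" for n
  proof -
    have "y * n - n * x = 0"
    proof (rule faithful_left)
      show "y * n - n * x \<in> peirce j i" using n x y by (intro peirce_diff peirce_mult)
      show "(y * n - n * x) * m = 0" if m: "m \<in> peirce i j" for m
        using tw[OF m] c2[OF peirce_mult[OF n m]] by (simp add: left_diff_distrib mult.assoc)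
    qed
    then show ?thesis by simp
  qed
  have "(x + y) * z - z * (x + y) = 0" if "z \<in> R" for z
  proof (rule additive_eq_0[OF _ _ that])
    fix z k l assume z: "z \<in> peirce k l"
    consider "k = i" "l = i" | "k = i" "l = j" | "k = j" "l = i" | "k = j" "l = j" using ij by blast
    then show "(x + y) * z - z * (x + y) = 0"
      by cases (use z c1 c2 c3 tw ij peirce_mult_0[OF x z] peirce_mult_0[OF y z] peirce_mult_0[OF z x] peirce_mult_0[OF z y]
        in \<open>auto simp: distrib_left distrib_right\<close>)
  qed (simp add: algebra_simps)
  then show ?thesis using xy by (simp add: ring_center_def)
qed

section \<open>Action of a Lie derivation on the corners\<close>

context
  fixes L :: "'a \<Rightarrow> 'a"
  assumes L_closed [simp]: "\<And>a. a \<in> R \<Longrightarrow> L a \<in> R"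
    and L_add: "\<And>a b. a \<in> R \<Longrightarrow> b \<in> R \<Longrightarrow> L (a + b) = L a + L b"
    and L_Lie: "\<And>a b. a \<in> R \<Longrightarrow> b \<in> R \<Longrightarrow> L (a * b - b * a) = (L a * b - b * L a) + (a * L b - L b * a)"
begin

lemma L_zero: "L 0 = 0"
  using L_add[of 0 0] by simp

text \<open>For \<open>m\<close> in the off-diagonal corner, \<open>m = e i * m - m * e i\<close>.
  Applying \<open>L\<close> and compressing to that corner, the terms in \<open>L m\<close> cancel
  and an intertwining relation for \<open>L (e i)\<close> remains.\<close>

lemma L_e_diagonal_central: "e i * L (e i) * e i + e (\<not> i) * L (e i) * e (\<not> i) \<in> ring_center"
proof (rule central_if_intertwining)
  fix m assume m: "m \<in> peirce i (\<not> i)"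
  have em: "e i * m = m" "m * e i = 0" "m * e (\<not> i) = m"
    using peirceD[OF m] peirce_e_right_0[OF m, of i] by auto
  have "L m = (L (e i) * m - m * L (e i)) + (e i * L m - L m * e i)"
    using L_Lie[of "e i" m] peirceD(1)[OF m] by (simp add: em)
  then have "e i * L m * e (\<not> i)
      = e i * ((L (e i) * m - m * L (e i)) + (e i * L m - L m * e i)) * e (\<not> i)"
    by (rule arg_cong)
  also have "\<dots> = (e i * L (e i) * (m * e (\<not> i)) - (e i * m) * L (e i) * e (\<not> i)) + e i * L m * e (\<not> i)"
    by (simp add: distrib_left distrib_right left_diff_distrib right_diff_distrib mult.assoc)
  finally have "e i * L (e i) * m = m * L (e i) * e (\<not> i)" by (simp add: em)
  then show "e i * L (e i) * e i * m = m * (e (\<not> i) * L (e i) * e (\<not> i))"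
    using em by (metis mult.assoc)
qed simp_all

section \<open>Lie derivations that map both idempotents into the centre\<close>

context
  assumes L_e: "\<And>i. L (e i) \<in> ring_center"
begin

text \<open>As \<open>L (e i)\<close> is central, \<open>L m\<close> inherits
  \<open>L m = e i * L m - L m * e i\<close>. Compressing this gives
  \<open>L m * e i = - (L m * e i)\<close>, and torsion-freeness does the rest.\<close>

lemma L_off_diagonal:
  assumes m: "m \<in> peirce i j" and "i \<noteq> j"
  shows "L m \<in> peirce i j"
proof -
  have R: "m \<in> R" using peirceD(1)[OF m] .
  have em: "e i * m = m" "m * e i = 0" using peirceD[OF m] peirce_e_right_0[OF m, of i] \<open>i \<noteq> j\<close> by auto
  have eq: "L m = e i * L m - L m * e i"
    using L_Lie[of "e i" m] R ring_center_commute[OF L_e[of i] R] by (simp add: em)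
  have "e i * L m = e i * (e i * L m - L m * e i)" using eq by (rule arg_cong)
  then have "e i * L m * e i = 0" by (simp add: right_diff_distrib mult.assoc)
  moreover have "L m * e i = (e i * L m - L m * e i) * e i" using eq by (rule arg_cong)
  ultimately have "L m * e i = - (L m * e i)" by (simp add: left_diff_distrib mult.assoc)
  then have 0: "L m * e i = 0" using torsion_free[of "L m * e i"] R by (simp add: eq_neg_iff_add_eq_0)
  then have 1: "e i * L m = L m" using eq by simp
  have "e j = 1 - e i" using e_sum[of i] \<open>i \<noteq> j\<close> by (cases i; cases j) (auto simp: algebra_simps)
  then have "L m * e j = L m" using 0 by (simp add: right_diff_distrib)
  then show ?thesis using 1 R by (simp add: peirce_def)
qed

lemma L_diagonal_commute:
  assumes a: "a \<in> peirce i i"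
  shows "e k * L a = L a * e k"
proof -
  have R: "a \<in> R" using peirceD(1)[OF a] .
  have "e k * a = a * e k" using peirceD(2,3)[OF a] peirce_e_left_0[OF a, of k] peirce_e_right_0[OF a, of k] by (cases "k = i") auto
  then show ?thesis
    using L_Lie[of "e k" a] R ring_center_commute[OF L_e[of k] R] by (simp add: L_zero)
qed

text \<open>Elements of opposite diagonal corners commute. Applying \<open>L\<close> to this and
  compressing to corner \<open>j\<close> kills the terms in \<open>L b\<close>, so the
  \<open>j\<close>-part of \<open>L a\<close> commutes with the whole corner.\<close>

lemma L_diagonal_opposite_corner:
  assumes a: "a \<in> peirce i i" and ij: "i \<noteq> j"
  shows "\<exists>c\<in>ring_center. e j * L a * e j = c * e j"
proof (rule corner_center)
  have R: "a \<in> R" using peirceD(1)[OF a] .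
  show "e j * L a * e j \<in> R" using R by simp
  show "e j * (e j * L a * e j) = e j * L a * e j" "e j * L a * e j * e j = e j * L a * e j"
    by (simp_all add: mult.assoc)
  fix x assume "x \<in> R"
  define b where "b = e j * x * e j"
  have b: "b \<in> peirce j j" using \<open>x \<in> R\<close> by (simp add: b_def)
  have ab: "a * b = 0" "b * a = 0" using peirce_mult_0[OF a b] peirce_mult_0[OF b a] ij by auto
  have ea: "e j * a = 0" "a * e j = 0" using peirce_e_left_0[OF a] peirce_e_right_0[OF a] ij by auto
  have eb: "e j * b = b" "b * e j = b" using peirceD[OF b] by auto
  have "(L a * b - b * L a) + (a * L b - L b * a) = 0"
    using L_Lie[OF R peirceD(1)[OF b]] by (simp add: ab L_zero)
  then have "e j * ((L a * b - b * L a) + (a * L b - L b * a)) * e j = 0" by simp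
  also have "e j * ((L a * b - b * L a) + (a * L b - L b * a)) * e j
      = (e j * L a * (b * e j) - (e j * b) * L a * e j) + ((e j * a) * L b * e j - e j * L b * (a * e j))"
    by (simp add: distrib_left distrib_right left_diff_distrib right_diff_distrib mult.assoc)
  finally have "e j * L a * b = b * L a * e j" by (simp add: ea eb)
  then have "e j * L a * (e j * b) = (b * e j) * L a * e j" by (simp only: eb)
  then show "e j * L a * e j * (e j * x * e j) = e j * x * e j * (e j * L a * e j)"
    unfolding b_def[symmetric] by (simp only: mult.assoc)
qed

text \<open>\<open>h\<close> collects, for each diagonal part of \<open>x\<close>, the central
  element that \<open>L\<close> produces in the opposite corner; subtracting it puts
  \<open>L a\<close> back into the corner of \<open>a\<close>.\<close>

lemma central_part_exists:
  obtains h where "\<And>x. x \<in> R \<Longrightarrow> h x \<in> ring_center" "\<And>x y. x \<in> R \<Longrightarrow> y \<in> R \<Longrightarrow> h (x + y) = h x + h y"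
    "\<And>m i j. m \<in> peirce i j \<Longrightarrow> i \<noteq> j \<Longrightarrow> h m = 0" "\<And>a i. a \<in> peirce i i \<Longrightarrow> L a - h a \<in> peirce i i"
proof -
  define c where "c i x = (SOME z. z \<in> ring_center \<and> e (\<not> i) * L (e i * x * e i) * e (\<not> i) = z * e (\<not> i))" for i x
  have c_props: "c i x \<in> ring_center \<and> e (\<not> i) * L (e i * x * e i) * e (\<not> i) = c i x * e (\<not> i)" if "x \<in> R" for i x
    unfolding c_def
    by (rule someI_ex) (use that L_diagonal_opposite_corner[of "e i * x * e i" i "\<not> i"] in auto)
  then have cZ: "\<And>i x. x \<in> R \<Longrightarrow> c i x \<in> ring_center"
    and c: "\<And>i x. x \<in> R \<Longrightarrow> e (\<not> i) * L (e i * x * e i) * e (\<not> i) = c i x * e (\<not> i)"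
    by auto
  \<comment> \<open>A central element is determined by its product with \<open>e j\<close>, so the
    values picked by \<open>SOME\<close> are additive.\<close>
  have uniq: "z = w" if "z \<in> ring_center" "w \<in> ring_center" "z * e j = w * e j" for z w j
    using ring_center_mult_eq_0[of "z - w" "e j"] that e_nonzero by (auto simp: left_diff_distrib ring_center_intros)
  have c_add: "c i (x + y) = c i x + c i y" if "x \<in> R" "y \<in> R" for i x y
  proof (rule uniq)
    show "c i (x + y) * e (\<not> i) = (c i x + c i y) * e (\<not> i)"
      using that by (simp add: distrib_right distrib_left L_add flip: c)
  qed (use that cZ ring_center_intros in auto)
  have c_eq0: "c i x = 0" if "x \<in> R" "e i * x * e i = 0" for i x
    by (rule uniq[of _ _ "\<not> i"]) (use that cZ ring_center_intros c[of x i] in \<open>simp_all add: L_zero\<close>)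
  show ?thesis
  proof (rule that[of "\<lambda>x. c True x + c False x"])
    show "c True x + c False x \<in> ring_center" if "x \<in> R" for x using that cZ ring_center_intros by auto
    show "c True (x + y) + c False (x + y) = c True x + c False x + (c True y + c False y)"
      if "x \<in> R" "y \<in> R" for x y using that by (simp add: c_add)
    show "c True m + c False m = 0" if m: "m \<in> peirce i j" and "i \<noteq> j" for m i j
    proof -
      have "e k * m * e k = 0" for k
        using peirce_e_left_0[OF m, of k] peirce_e_right_0[OF m, of k] \<open>i \<noteq> j\<close>
        by (cases "k = i") (auto simp: mult.assoc)
      then show ?thesis using c_eq0[OF peirceD(1)[OF m]] by simp
    qed
    show "L a - (c True a + c False a) \<in> peirce i i" if a: "a \<in> peirce i i" for a i
    proof -
      have R: "a \<in> R" using peirceD(1)[OF a] .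
      define z where "z = c True a + c False a"
      have zZ: "z \<in> ring_center" using R cZ ring_center_intros by (auto simp: z_def)
      have "e (\<not> i) * a * e (\<not> i) = 0" using peirce_e_left_0[OF a, of "\<not> i"] by simp
      then have "z = c i a" using c_eq0[OF R, of "\<not> i"] by (cases i) (auto simp: z_def)
      moreover have "e i * a * e i = a" using peirceD[OF a] by simp
      ultimately have "e (\<not> i) * L a * e (\<not> i) = z * e (\<not> i)" using c[OF R, of i] by simp
      then have 1: "L a * e (\<not> i) = z * e (\<not> i)"
        using L_diagonal_commute[OF a, of "\<not> i"] by (simp add: mult.assoc)
      then have 2: "e (\<not> i) * L a = e (\<not> i) * z"
        using L_diagonal_commute[OF a, of "\<not> i"] ring_center_commute[OF zZ, of "e (\<not> i)"] by simp
      have ei: "e i = 1 - e (\<not> i)" using e_sum[of i] by (simp add: algebra_simps)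
      have "e i * (L a - z) = L a - z" unfolding ei using 2 by (simp add: algebra_simps)
      moreover have "(L a - z) * e i = L a - z" unfolding ei using 1 by (simp add: algebra_simps)
      ultimately show ?thesis using R zZ ring_center_closed by (simp add: peirce_def z_def)
    qed
  qed
qed

lemma normalised_Lie_derivation:
  "\<exists>\<tau>. (\<forall>x\<in>R. \<tau> x \<in> R) \<and> (\<forall>x\<in>R. \<forall>y\<in>R. \<tau> (x + y) = \<tau> x + \<tau> y)
    \<and> (\<forall>x\<in>R. \<forall>y\<in>R. \<tau> (x * y) = \<tau> x * y + x * \<tau> y) \<and> (\<forall>x\<in>R. L x - \<tau> x \<in> ring_center)"
proof -
  obtain h where hZ: "\<And>x. x \<in> R \<Longrightarrow> h x \<in> ring_center"
    and h_add: "\<And>x y. x \<in> R \<Longrightarrow> y \<in> R \<Longrightarrow> h (x + y) = h x + h y"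
    and h_off: "\<And>m i j. m \<in> peirce i j \<Longrightarrow> i \<noteq> j \<Longrightarrow> h m = 0"
    and h_diag: "\<And>a i. a \<in> peirce i i \<Longrightarrow> L a - h a \<in> peirce i i"
    using central_part_exists by blast
  define \<tau> where "\<tau> x = L x - h x" for x
  have L_eq: "L x = \<tau> x + h x" for x by (simp add: \<tau>_def)
  have \<tau>_R [simp]: "\<tau> x \<in> R" if "x \<in> R" for x using that hZ ring_center_closed by (simp add: \<tau>_def)
  have \<tau>_add: "\<tau> (x + y) = \<tau> x + \<tau> y" if "x \<in> R" "y \<in> R" for x y
    using that by (simp add: \<tau>_def L_add h_add)
  have \<tau>_zero: "\<tau> 0 = 0" using \<tau>_add[of 0 0] by simp
  have \<tau>_diff: "\<tau> (x - y) = \<tau> x - \<tau> y" if "x \<in> R" "y \<in> R" for x y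
    using \<tau>_add[of "x - y" y] that by simp
  have \<tau>_Pc: "\<tau> x \<in> peirce i j" if "x \<in> peirce i j" for x i j
    using that L_off_diagonal h_off h_diag unfolding \<tau>_def by (cases "i = j") auto
  have \<tau>_Lie: "\<tau> (x * y - y * x) + h (x * y - y * x) = (\<tau> x * y - y * \<tau> x) + (x * \<tau> y - \<tau> y * x)"
    if "x \<in> R" "y \<in> R" for x y
    using L_Lie[OF that] ring_center_commute[OF hZ[OF that(1)] that(2)] ring_center_commute[OF hZ[OF that(2)] that(1)]
    unfolding L_eq by (simp add: algebra_simps)
  \<comment> \<open>One of the two products in the commutator vanishes and \<open>h\<close> is 0 off
    the diagonal, so the Lie identity already is the Leibniz rule; \<open>mb\<close> is the mirror
    image.\<close>
  have am: "\<tau> (a * m) = \<tau> a * m + a * \<tau> m" if a: "a \<in> peirce i i" and m: "m \<in> peirce i j" and "i \<noteq> j" for a m i j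
    using \<tau>_Lie[OF peirceD(1)[OF a] peirceD(1)[OF m]] peirce_mult_0[OF m a] peirce_mult_0[OF m \<tau>_Pc[OF a]]
      peirce_mult_0[OF \<tau>_Pc[OF m] a] h_off[OF peirce_mult[OF a m]] \<open>i \<noteq> j\<close> by simp
  have mb: "\<tau> (m * b) = \<tau> m * b + m * \<tau> b" if b: "b \<in> peirce j j" and m: "m \<in> peirce i j" and "i \<noteq> j" for b m i j
    using \<tau>_Lie[OF peirceD(1)[OF m] peirceD(1)[OF b]] peirce_mult_0[OF b m] peirce_mult_0[OF b \<tau>_Pc[OF m]]
      peirce_mult_0[OF \<tau>_Pc[OF b] m] h_off[OF peirce_mult[OF m b]] \<open>i \<noteq> j\<close> by simp
  have aa: "\<tau> (a * b) = \<tau> a * b + a * \<tau> b" if a: "a \<in> peirce i i" and b: "b \<in> peirce i i" for a b i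
  proof -
    have "\<tau> (a * b) - (\<tau> a * b + a * \<tau> b) = 0"
    proof (rule faithful_left)
      show "\<tau> (a * b) - (\<tau> a * b + a * \<tau> b) \<in> peirce i i"
        using a b by (intro peirce_diff peirce_add peirce_mult \<tau>_Pc)
      show "(\<tau> (a * b) - (\<tau> a * b + a * \<tau> b)) * m = 0" if m: "m \<in> peirce i (\<not> i)" for m
        using am[OF peirce_mult[OF a b] m] am[OF a peirce_mult[OF b m]] am[OF b m]
        by (simp add: algebra_simps)
    qed
    then show ?thesis by simp
  qed
  \<comment> \<open>Here both products survive and a central \<open>z = h (m * n - n * m)\<close>
    appears. With \<open>U\<close>, \<open>V\<close> the Leibniz defects at \<open>m * n\<close> and
    \<open>n * m\<close>, the Lie identity gives \<open>V = U + z\<close>, so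
    \<open>U * m = - (z * m)\<close> and \<open>m * V = z * m\<close>. Evaluating \<tau> at
    \<open>m * n * m\<close> in two ways gives \<open>U * m = m * V\<close>, hence
    \<open>z = 0\<close> if \<open>m\<close> is nonzero. Then \<open>U = V\<close> lies in two
    different corners.\<close>
  have mn: "\<tau> (m * n) = \<tau> m * n + m * \<tau> n" if m: "m \<in> peirce i j" and n: "n \<in> peirce j i" and ij: "i \<noteq> j" for m n i j
  proof (cases "m = 0")
    case True
    then show ?thesis by (simp add: \<tau>_zero)
  next
    case False
    define z where "z = h (m * n - n * m)"
    define U where "U = \<tau> (m * n) - (\<tau> m * n + m * \<tau> n)"
    define V where "V = \<tau> (n * m) - (\<tau> n * m + n * \<tau> m)"
    note mnR = peirceD(1)[OF m] peirceD(1)[OF n]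
    have zZ: "z \<in> ring_center" using mnR by (simp add: z_def hZ)
    have U: "U \<in> peirce i i" unfolding U_def by (rule peirce_diff[OF _ peirce_add]) (rule \<tau>_Pc peirce_mult m n)+
    have V: "V \<in> peirce j j" unfolding V_def by (rule peirce_diff[OF _ peirce_add]) (rule \<tau>_Pc peirce_mult m n)+
    have UV: "V = U + z"
      using \<tau>_Lie[OF mnR] mnR \<tau>_diff[of "m * n" "n * m"] by (simp add: U_def V_def z_def algebra_simps)
    have "V * m = 0" "m * U = 0" using peirce_mult_0[OF V m] peirce_mult_0[OF m U] ij by auto
    then have "U * m = - (z * m)" "m * V = z * m"
      using UV ring_center_commute[OF zZ mnR(1)] by (simp_all add: distrib_left distrib_right eq_neg_iff_add_eq_0)
    moreover have "U * m = m * V"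
      using am[OF peirce_mult[OF m n] m ij] mb[OF peirce_mult[OF n m] m ij]
      by (simp add: U_def V_def algebra_simps)
    ultimately have "z * m = - (z * m)" by simp
    then have "z * m + z * m = 0" by (simp only: eq_neg_iff_add_eq_0)
    then have "z * m = 0" using torsion_free[of "z * m"] ring_center_closed[OF zZ] mnR(1) by simp
    then have "z = 0" using ring_center_mult_eq_0[OF zZ mnR(1)] False by blast
    then have "U = 0" using UV peirce_disjoint[OF U, of j j] V ij by simp
    then show ?thesis by (simp add: U_def)
  qed
  define D where "D x y = \<tau> (x * y) - (\<tau> x * y + x * \<tau> y)" for x y
  have D_Pc: "D x y = 0" if x: "x \<in> peirce i j" and y: "y \<in> peirce k l" for x y i j k l
  proof (cases "j = k")
    case False
    then show ?thesis
      using peirce_mult_0[OF x y] peirce_mult_0[OF \<tau>_Pc[OF x] y] peirce_mult_0[OF x \<tau>_Pc[OF y]]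
      by (simp add: D_def \<tau>_zero)
  next
    case True
    then have y: "y \<in> peirce j l" using y by simp
    consider "i = j" "j = l" | "i = j" "j \<noteq> l" | "i \<noteq> j" "j = l" | "i \<noteq> j" "i = l" by blast
    then have "\<tau> (x * y) = \<tau> x * y + x * \<tau> y"
      by cases (use x y aa am mb mn in auto)
    then show ?thesis by (simp add: D_def)
  qed
  have D_add: "D (x + x') y = D x y + D x' y" "D y (x + x') = D y x + D y x'"
    if "x \<in> R" "x' \<in> R" "y \<in> R" for x x' y
    using that by (simp_all add: D_def \<tau>_add distrib_left distrib_right)
  have "D x y = 0" if "x \<in> R" "y \<in> R" for x y
  proof (rule additive_eq_0[OF _ _ that(1)])
    show "D x y = 0" if x: "x \<in> peirce i j" for x i j
      by (rule additive_eq_0[OF _ _ \<open>y \<in> R\<close>]) (use D_Pc[OF x] D_add peirceD(1)[OF x] in auto)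
  qed (use that D_add in auto)
  then have "\<tau> (x * y) = \<tau> x * y + x * \<tau> y" if "x \<in> R" "y \<in> R" for x y
    using that by (simp add: D_def)
  then show ?thesis
    using \<tau>_R \<tau>_add hZ by (intro exI[of _ \<tau>]) (simp add: \<tau>_def)
qed

end

end

theorem Lie_derivation_standard_form:
  assumes L_closed: "\<And>a. a \<in> R \<Longrightarrow> L a \<in> R"
    and L_add: "\<And>a b. a \<in> R \<Longrightarrow> b \<in> R \<Longrightarrow> L (a + b) = L a + L b"
    and L_Lie: "\<And>a b. a \<in> R \<Longrightarrow> b \<in> R \<Longrightarrow> L (a * b - b * a) = (L a * b - b * L a) + (a * L b - L b * a)"
  shows "\<exists>\<tau>. (\<forall>x\<in>R. \<tau> x \<in> R) \<and> (\<forall>x\<in>R. \<forall>y\<in>R. \<tau> (x + y) = \<tau> x + \<tau> y)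
    \<and> (\<forall>x\<in>R. \<forall>y\<in>R. \<tau> (x * y) = \<tau> x * y + x * \<tau> y) \<and> (\<forall>x\<in>R. L x - \<tau> x \<in> ring_center)"
proof -
  let ?p = "e True" and ?q = "e False"
  define x where "x = L ?p"
  \<comment> \<open>Chosen so that \<open>s * ?p - ?p * s\<close> is the off-diagonal part of
    \<open>L ?p\<close>; subtracting this inner derivation makes \<open>K ?p\<close> diagonal, hence
    central.\<close>
  define s where "s = ?q * x * ?p - ?p * x * ?q"
  define K where "K a = L a - (s * a - a * s)" for a
  have xR: "x \<in> R" by (simp add: x_def L_closed)
  then have sR: "s \<in> R" by (simp add: s_def)
  have K_closed: "K a \<in> R" if "a \<in> R" for a using that sR L_closed by (simp add: K_def)
  have K_add: "K (a + b) = K a + K b" if "a \<in> R" "b \<in> R" for a b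
    using that by (simp add: K_def L_add algebra_simps)
  have K_Lie: "K (a * b - b * a) = (K a * b - b * K a) + (a * K b - K b * a)" if "a \<in> R" "b \<in> R" for a b
    unfolding K_def L_Lie[OF that] by (simp add: algebra_simps)
  have Kp: "K ?p \<in> ring_center"
  proof -
    have "K ?p = x - (?q * x * ?p + ?p * x * ?q)"
      unfolding K_def x_def[symmetric] s_def
      by (simp add: left_diff_distrib right_diff_distrib mult.assoc)
    also have "\<dots> = ?p * x * ?p + ?q * x * ?q"
      by (subst (1) decompose[of x True]) (simp add: algebra_simps)
    also have "\<dots> \<in> ring_center"
      using L_e_diagonal_central[of L True, OF L_closed L_add L_Lie] by (simp add: x_def)
    finally show ?thesis .
  qed
  \<comment> \<open>Everything commutes with 1, so the Lie identity makes \<open>K 1\<close>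
    central; this gives the second idempotent as the difference.\<close>
  have K1: "K 1 \<in> ring_center"
  proof -
    have "K 1 * a - a * K 1 = 0" if "a \<in> R" for a
      using K_Lie[OF one_closed that] K_add[of 0 0] by simp
    then show ?thesis using K_closed[of 1] by (simp add: ring_center_def)
  qed
  have "K 1 = K ?p + K ?q" using K_add[of ?p ?q] e_sum[of True] by simp
  then have "K ?q = K 1 - K ?p" by simp
  then have "K ?q \<in> ring_center" using ring_center_intros(3)[OF K1 Kp] by simp
  then have K_e: "K (e i) \<in> ring_center" for i using Kp by (cases i) auto
  from normalised_Lie_derivation[of K, OF K_closed K_add K_Lie K_e] obtain \<tau>
    where \<tau>: "\<forall>x\<in>R. \<tau> x \<in> R" "\<forall>x\<in>R. \<forall>y\<in>R. \<tau> (x + y) = \<tau> x + \<tau> y"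
      "\<forall>x\<in>R. \<forall>y\<in>R. \<tau> (x * y) = \<tau> x * y + x * \<tau> y" "\<forall>x\<in>R. K x - \<tau> x \<in> ring_center"
    by blast
  show ?thesis
  proof (intro exI[of _ "\<lambda>a. \<tau> a + (s * a - a * s)"] conjI ballI)
    show "\<tau> a + (s * a - a * s) \<in> R" if "a \<in> R" for a using that \<tau>(1) sR by simp
    show "\<tau> (a + b) + (s * (a + b) - (a + b) * s) = \<tau> a + (s * a - a * s) + (\<tau> b + (s * b - b * s))"
      if "a \<in> R" "b \<in> R" for a b using that by (simp add: \<tau>(2) algebra_simps)
    show "\<tau> (a * b) + (s * (a * b) - a * b * s)
        = (\<tau> a + (s * a - a * s)) * b + a * (\<tau> b + (s * b - b * s))"
      if "a \<in> R" "b \<in> R" for a b using that by (simp add: \<tau>(3) algebra_simps)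
    show "L a - (\<tau> a + (s * a - a * s)) \<in> ring_center" if "a \<in> R" for a
      using \<tau>(4) that by (simp add: K_def algebra_simps)
  qed
qed

end

section \<open>Derivations of factors\<close>

text \<open>\<open>D\<close> kills integers, so applying it to \<open>p(x) = 0\<close> gives
  \<open>p'(x) * D x = 0\<close>. If \<open>p'(x)\<close> vanishes too, \<open>p'\<close> is a
  polynomial of smaller degree to continue with, so no minimal polynomial is called for.\<close>

lemma field_derivation_algebraic:
  fixes D :: "'a::field_char_0 \<Rightarrow> 'a"
  assumes add: "\<And>a b. D (a + b) = D a + D b" and Leibniz: "\<And>a b. D (a * b) = D a * b + a * D b"
    and "algebraic x"
  shows "D x = 0"
proof -
  have D0: "D 0 = 0" using add[of 0 0] by simp
  have D1: "D 1 = 0" using Leibniz[of 1 1] by simp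
  have D_nat: "D (of_nat n) = 0" for n by (induction n) (simp_all add: D0 D1 add)
  have D_minus: "D (- a) = - D a" for a using add[of a "- a"] by (simp add: D0 eq_neg_iff_add_eq_0 add.commute)
  have D_int: "D a = 0" if a: "a \<in> \<int>" for a
  proof -
    obtain z where "a = of_int z" using a by (rule Ints_cases)
    then show ?thesis by (cases z rule: int_cases2) (simp_all add: D_nat D_minus)
  qed
  have D_poly: "D (poly p x) = poly (pderiv p) x * D x" if "\<And>i. coeff p i \<in> \<int>" for p
    using that
  proof (induction p)
    case (pCons a p)
    have "D a = 0" using pCons.prems[of 0] D_int by simp
    moreover have "coeff p i \<in> \<int>" for i using pCons.prems[of "Suc i"] by simp
    ultimately show ?case
      using pCons.IH by (simp add: add Leibniz pderiv_pCons algebra_simps)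
  qed (simp add: D0)
  have "D x = 0" if "p \<noteq> 0" "poly p x = 0" "\<And>i. coeff p i \<in> \<int>" for p
    using that
  proof (induction "degree p" arbitrary: p rule: less_induct)
    case less
    show ?case
    proof (cases "poly (pderiv p) x = 0")
      case True
      have "degree p \<noteq> 0"
      proof
        assume "degree p = 0"
        then obtain c where "p = [:c:]" by (rule degree_eq_zeroE)
        then show False using less.prems by simp
      qed
      moreover from this have "pderiv p \<noteq> 0" by (simp add: pderiv_eq_0_iff)
      ultimately show ?thesis
        using True less.prems(3) by (intro less.hyps[of "pderiv p"]) (auto simp: degree_pderiv coeff_pderiv)
    next
      case False
      then show ?thesis using D_poly[of p] less.prems by (simp add: D0)
    qed
  qed
  then show ?thesis using \<open>algebraic x\<close> unfolding algebraic_def by blast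
qed

section \<open>Transfer of the ring theorems to factors\<close>

lemma bop_torsion_free: "A + A = 0 \<Longrightarrow> A = 0" for A :: "'h::complex_hilbert bop"
  using bop_scaleC_add_left[of 1 1 A] bop_scaleC_eq_0_iff[of 2 A] by simp

lemma factor_prime_subring:
  assumes M: "factor M"
  shows "prime_subring M"
proof unfold_locales
  show "a = 0 \<or> b = 0" if "a \<in> M" "b \<in> M" "\<And>x. x \<in> M \<Longrightarrow> a * x * b = 0" for a b
    using factor_prime[OF M that] .
  show "a = 0" if "a \<in> M" "a + a = 0" for a
    using that(2) by (rule bop_torsion_free)
qed (simp_all add: von_neumann_closed[OF factor_von_neumann[OF M]])

lemma factor_ring_center_iff:
  assumes "factor M"
  shows "X \<in> prime_subring.ring_center M \<longleftrightarrow> (\<exists>c. X = c *\<^sub>C 1)"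
proof -
  have "prime_subring.ring_center M = center M"
    using prime_subring.ring_center_def[OF factor_prime_subring[OF assms]] by (simp add: center_def)
  then show ?thesis using assms by (auto simp: factor_def scalar_ops_def)
qed

lemma factor_noncommutative:
  assumes "factor M" "M \<noteq> scalar_ops"
  shows "\<not> (\<forall>A\<in>M. \<forall>B\<in>M. A * B = B * A)"
  using assms unfolding factor_def center_def by blast

lemma factor_peirce_decomposition:
  assumes M: "factor M" "M \<noteq> scalar_ops"
  obtains e where "peirce_decomposition M e"
proof -
  interpret prime_subring M using M(1) by (rule factor_prime_subring)
  obtain P where P: "P \<in> M" "is_adjoint P P" "P * P = P" "P \<noteq> 0" "P \<noteq> 1"
    using factor_nontrivial_projection[OF M] by blast
  define e where "e i = (if i then P else 1 - P)" for i
  have e: "e i \<in> M" "is_adjoint (e i) (e i)" "e i * e i = e i" for i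
    using P is_adjoint_diff[OF is_adjoint_one P(2)] by (auto simp: e_def algebra_simps)
  have "peirce_decomposition M e"
  proof unfold_locales
    fix z i assume z: "z \<in> M" "e i * z = z" "z * e i = z"
      "\<And>x. x \<in> M \<Longrightarrow> z * (e i * x * e i) = e i * x * e i * z"
    obtain c where "z = c *\<^sub>C e i" using factor_corner_center[OF M(1) e z] by blast
    then have "z = (c *\<^sub>C 1) * e i" by simp
    moreover have "c *\<^sub>C 1 \<in> ring_center" using factor_ring_center_iff[OF M(1)] by blast
    ultimately show "\<exists>c\<in>ring_center. z = c * e i" by blast
  qed (use e P in \<open>auto simp: e_def\<close>)
  then show ?thesis by (rule that)
qed

lemma factor_Lie_derivation:
  assumes M: "factor M" and L: "additive_xi_lie_derivation 1 M L"
  obtains \<tau> where "additive_derivation M \<tau>" "\<And>A. A \<in> M \<Longrightarrow> \<exists>c. L A - \<tau> A = c *\<^sub>C 1"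
proof (cases "M = scalar_ops")
  case True
  show ?thesis
  proof (rule that[of "\<lambda>_. 0"])
    show "additive_derivation M (\<lambda>_. 0)"
      using von_neumann_closed(1)[OF factor_von_neumann[OF M]]
      by (simp add: additive_derivation_def additive_on_def)
    show "\<exists>c. L A - 0 = c *\<^sub>C 1" if "A \<in> M" for A
      using L that True unfolding additive_xi_lie_derivation_def scalar_ops_def by fastforce
  qed
next
  case False
  obtain e where "peirce_decomposition M e" by (rule factor_peirce_decomposition[OF M False])
  then interpret peirce_decomposition M e .
  have "\<exists>\<tau>. (\<forall>x\<in>M. \<tau> x \<in> M) \<and> (\<forall>x\<in>M. \<forall>y\<in>M. \<tau> (x + y) = \<tau> x + \<tau> y)
    \<and> (\<forall>x\<in>M. \<forall>y\<in>M. \<tau> (x * y) = \<tau> x * y + x * \<tau> y) \<and> (\<forall>x\<in>M. L x - \<tau> x \<in> ring_center)"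
    using L unfolding additive_xi_lie_derivation_def additive_on_def xi_commutator_def
    by (intro Lie_derivation_standard_form) auto
  then show ?thesis
    using that factor_ring_center_iff[OF M] unfolding additive_derivation_def additive_on_def by blast
qed

lemma factor_xi_Lie_derivation:
  assumes M: "factor M" "M \<noteq> scalar_ops" and L: "additive_xi_lie_derivation \<xi> M L"
    and \<xi>: "\<xi> \<noteq> 1" "\<xi> \<noteq> - 1"
  shows "additive_derivation M L" "A \<in> M \<Longrightarrow> L (\<xi> *\<^sub>C A) = \<xi> *\<^sub>C L A"
proof -
  interpret prime_subring M using M(1) by (rule factor_prime_subring)
  have scale [simp]: "c *\<^sub>C A \<in> M" if "A \<in> M" for c A
    using von_neumann_closed(6)[OF factor_von_neumann[OF M(1)] that] .
  have L_closed [simp]: "L A \<in> M" if "A \<in> M" for A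
    using L that by (auto simp: additive_xi_lie_derivation_def)
  have L_add: "L (A + B) = L A + L B" if "A \<in> M" "B \<in> M" for A B
    using L that by (simp add: additive_xi_lie_derivation_def additive_on_def)
  have L_diff: "L (A - B) = L A - L B" if "A \<in> M" "B \<in> M" for A B
    using L_add[of "A - B" B] that by simp
  have L_xi: "L (A * B - \<xi> *\<^sub>C (B * A)) = (L A * B - \<xi> *\<^sub>C (B * L A)) + (A * L B - \<xi> *\<^sub>C (L B * A))"
    if "A \<in> M" "B \<in> M" for A B
    using L that by (simp add: additive_xi_lie_derivation_def xi_commutator_def)
  \<comment> \<open>The \<xi>-commutators of \<open>A\<close> with 1 in either order coincide;
    comparing their images leaves the factor \<open>1 + \<xi>\<close>.\<close>
  have "L 1 * A = A * L 1" if A: "A \<in> M" for A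
  proof -
    have "A * L 1 - \<xi> *\<^sub>C (L 1 * A) = L 1 * A - \<xi> *\<^sub>C (A * L 1)"
      using L_xi[OF A one_closed] L_xi[OF one_closed A] by simp
    then have "(1 + \<xi>) *\<^sub>C (L 1 * A - A * L 1) = 0"
      by (simp add: bop_scaleC_add_left bop_scaleC_diff_right algebra_simps)
    then show ?thesis using \<xi>(2) by (simp add: eq_neg_iff_add_eq_0 add.commute)
  qed
  then obtain c where L1: "L 1 = c *\<^sub>C 1" using factor_centralE[OF M(1), of "L 1"] by auto
  \<comment> \<open>The failure of \<open>L\<close> to commute with multiplication by \<xi>, read
    off from the \<xi>-commutator of \<open>A\<close> with 1.\<close>
  define k where "k = (1 - \<xi>) * c"
  have L_scale: "L (\<xi> *\<^sub>C A) = \<xi> *\<^sub>C L A - k *\<^sub>C A" if A: "A \<in> M" for A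
    using L_xi[OF A one_closed] L_diff[OF A, of "\<xi> *\<^sub>C A"] A
    by (simp add: L1 k_def bop_scaleC_diff_left algebra_simps)
  define \<delta> where "\<delta> A B = L (A * B) - L A * B - A * L B" for A B
  have \<delta>_swap: "\<delta> A B = \<xi> *\<^sub>C \<delta> B A - k *\<^sub>C (B * A)" if "A \<in> M" "B \<in> M" for A B
    using L_xi[OF that] that
    by (simp add: \<delta>_def L_diff L_scale bop_scaleC_diff_right bop_scaleC_add_right algebra_simps)
  \<comment> \<open>\<open>\<delta>_swap\<close> used twice returns to \<open>\<delta> A B\<close>
    with factor \<open>\<xi> * \<xi>\<close>.\<close>
  have \<delta>_eq: "(1 - \<xi> * \<xi>) *\<^sub>C \<delta> A B = (- k) *\<^sub>C (\<xi> *\<^sub>C (A * B) + B * A)"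
    if "A \<in> M" "B \<in> M" for A B
  proof -
    have "\<delta> A B = \<xi> *\<^sub>C (\<xi> *\<^sub>C \<delta> A B - k *\<^sub>C (A * B)) - k *\<^sub>C (B * A)"
      using \<delta>_swap[OF that] \<delta>_swap[OF that(2,1)] by metis
    then show ?thesis
      by (simp add: bop_scaleC_diff_right bop_scaleC_diff_left bop_scaleC_minus_left bop_scaleC_add_right
          algebra_simps)
  qed
  have cocycle: "A * \<delta> B C - \<delta> (A * B) C + \<delta> A (B * C) - \<delta> A B * C = 0" for A B C
    by (simp add: \<delta>_def algebra_simps)
  have "c = 0"
  proof (rule ccontr)
    assume "c \<noteq> 0"
    have "(A * C - C * A) * B = B * (A * C - C * A)" if ABC: "A \<in> M" "B \<in> M" "C \<in> M" for A B C
    proof -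
      have "0 = (1 - \<xi> * \<xi>) *\<^sub>C (A * \<delta> B C - \<delta> (A * B) C + \<delta> A (B * C) - \<delta> A B * C)"
        by (simp add: cocycle)
      also have "\<dots> = A * ((1 - \<xi> * \<xi>) *\<^sub>C \<delta> B C) - (1 - \<xi> * \<xi>) *\<^sub>C \<delta> (A * B) C
          + (1 - \<xi> * \<xi>) *\<^sub>C \<delta> A (B * C) - ((1 - \<xi> * \<xi>) *\<^sub>C \<delta> A B) * C"
        by (simp add: bop_scaleC_diff_right bop_scaleC_add_right)
      \<comment> \<open>In the cocycle identity the part \<open>\<xi> A B\<close> cancels by
        associativity; the part \<open>B A\<close> leaves the commutator of
        \<open>A * C - C * A\<close> with \<open>B\<close>.\<close>
      also have "\<dots> = (- k) *\<^sub>C ((A * C - C * A) * B - B * (A * C - C * A))"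
        using ABC by (simp only: \<delta>_eq mult_closed)
          (simp add: bop_scaleC_diff_right bop_scaleC_add_right bop_scaleC_minus_left algebra_simps)
      finally show ?thesis using \<xi>(1) \<open>c \<noteq> 0\<close> by (auto simp: k_def)
    qed
    then have "A * C - C * A \<in> ring_center" if "A \<in> M" "C \<in> M" for A C
      using that by (simp add: ring_center_def)
    then have "\<forall>A\<in>M. \<forall>B\<in>M. A * B = B * A" using commutative_if_commutators_central by blast
    then show False using factor_noncommutative[OF M] by blast
  qed
  have "1 - \<xi> * \<xi> \<noteq> 0" using \<xi> by (metis eq_iff_diff_eq_0 square_eq_1_iff)
  then have "\<delta> A B = 0" if "A \<in> M" "B \<in> M" for A B
    using \<delta>_eq[OF that] \<open>c = 0\<close> by (simp add: k_def)
  then have "L (A * B) = L A * B + A * L B" if "A \<in> M" "B \<in> M" for A B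
    using that by (simp add: \<delta>_def algebra_simps)
  then show "additive_derivation M L"
    using L_closed L_add by (auto simp: additive_derivation_def additive_on_def)
  show "L (\<xi> *\<^sub>C A) = \<xi> *\<^sub>C L A" if "A \<in> M"
    using L_scale[OF that] \<open>c = 0\<close> by (simp add: k_def)
qed

lemma factor_Jordan_derivation:
  assumes M: "factor M" "M \<noteq> scalar_ops" and L: "additive_xi_lie_derivation (- 1) M L"
  shows "additive_derivation M L" "A \<in> M \<Longrightarrow> L ((- 1) *\<^sub>C A) = (- 1) *\<^sub>C L A"
proof -
  interpret prime_subring M using M(1) by (rule factor_prime_subring)
  have L_closed: "L A \<in> M" if "A \<in> M" for A
    using L that by (auto simp: additive_xi_lie_derivation_def)
  have L_add: "L (A + B) = L A + L B" if "A \<in> M" "B \<in> M" for A B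
    using L that by (simp add: additive_xi_lie_derivation_def additive_on_def)
  have "L (A * B + B * A) = L A * B + B * L A + (A * L B + L B * A)" if "A \<in> M" "B \<in> M" for A B
    using L that by (simp add: additive_xi_lie_derivation_def xi_commutator_def bop_scaleC_minus_left)
  then have "\<forall>A\<in>M. \<forall>B\<in>M. L (A * B) = L A * B + A * L B"
    using Jordan_derivation_is_derivation[of L] L_closed L_add factor_noncommutative[OF M] by blast
  then show "additive_derivation M L"
    using L_closed L_add by (auto simp: additive_derivation_def additive_on_def)
  show "L ((- 1) *\<^sub>C A) = (- 1) *\<^sub>C L A" if A: "A \<in> M"
    using L_add[OF A diff_closed[OF zero_closed A]] L_add[of 0 0]
    by (simp add: bop_scaleC_minus_left eq_neg_iff_add_eq_0 add.commute)
qed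

lemma scalar_xi_Lie_derivation:
  fixes L :: "'h::complex_hilbert bop \<Rightarrow> 'h bop"
  assumes L: "additive_xi_lie_derivation \<xi> scalar_ops L" and \<xi>: "\<xi> \<noteq> 1" "algebraic \<xi>"
  shows "additive_derivation scalar_ops L" "A \<in> scalar_ops \<Longrightarrow> L (\<xi> *\<^sub>C A) = \<xi> *\<^sub>C L A"
proof -
  have all: "additive_derivation scalar_ops L \<and> (\<forall>A\<in>scalar_ops. L (\<xi> *\<^sub>C A) = \<xi> *\<^sub>C L A)"
  \<comment> \<open>On the zero Hilbert space the coordinate of a scalar operator is not determined,
    so \<open>inj\<close> below would fail.\<close>
  proof (cases "(1 :: 'h bop) = 0")
    case True
    then have "A = 0" for A :: "'h bop" by (metis mult_1_left mult_zero_left)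
    then have "A = B" for A B :: "'h bop" by metis
    then show ?thesis
      using L by (auto simp: additive_derivation_def additive_xi_lie_derivation_def)
  next
    case False
    have inj: "a *\<^sub>C (1 :: 'h bop) = b *\<^sub>C 1 \<longleftrightarrow> a = b" for a b
      using bop_scaleC_eq_0_iff[of "a - b" "1 :: 'h bop"] False by (simp add: bop_scaleC_diff_left)
    have "\<exists>b. L (a *\<^sub>C 1) = b *\<^sub>C 1" for a
      using L unfolding additive_xi_lie_derivation_def scalar_ops_def by blast
    then obtain f where f: "\<And>a. L (a *\<^sub>C 1) = f a *\<^sub>C 1" by metis
    have in_scalar: "a *\<^sub>C 1 \<in> scalar_ops" for a by (simp add: scalar_ops_def)
    have f_add: "f (a + b) = f a + f b" for a b
    proof -
      have "L (a *\<^sub>C 1 + b *\<^sub>C 1) = L (a *\<^sub>C 1) + L (b *\<^sub>C 1)"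
        using L in_scalar unfolding additive_xi_lie_derivation_def additive_on_def by blast
      then show ?thesis by (simp add: f inj flip: bop_scaleC_add_left)
    qed
    have f_xi: "f ((1 - \<xi>) * (a * b)) = (1 - \<xi>) * (f a * b + a * f b)" for a b
    proof -
      have "L (xi_commutator \<xi> (a *\<^sub>C 1) (b *\<^sub>C 1))
          = xi_commutator \<xi> (L (a *\<^sub>C 1)) (b *\<^sub>C 1) + xi_commutator \<xi> (a *\<^sub>C 1) (L (b *\<^sub>C 1))"
        using L in_scalar unfolding additive_xi_lie_derivation_def by blast
      then show ?thesis
        by (simp add: xi_commutator_def f inj flip: bop_scaleC_add_left bop_scaleC_diff_left)
          (simp add: algebra_simps)
    qed
    \<comment> \<open>Both instances of \<open>f_xi\<close> have the same left-hand side.\<close>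
    have f_mult: "f (a * b) + a * b * f 1 = f a * b + a * f b" for a b
      using f_xi[of a b] f_xi[of "a * b" 1] \<xi>(1) by simp
    define D where "D a = f a - a * f 1" for a
    have D: "D \<xi> = 0"
    proof (rule field_derivation_algebraic[OF _ _ \<xi>(2)])
      show "D (a + b) = D a + D b" for a b by (simp add: D_def f_add algebra_simps)
      show "D (a * b) = D a * b + a * D b" for a b
        using f_mult[of a b] by (simp add: D_def algebra_simps)
    qed
    \<comment> \<open>Additivity with \<open>D \<xi> = 0\<close> makes \<open>f (1 - \<xi>)\<close>
      equal to \<open>(1 - \<xi>) * f 1\<close>, while \<open>f_xi\<close> at \<open>1, 1\<close>
      gives twice that; hence \<open>f 1 = 0\<close>.\<close>
    have "f (1 - \<xi>) = f 1 - f \<xi>" using f_add[of "1 - \<xi>" \<xi>] by simp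
    then have eq: "f (1 - \<xi>) = (1 - \<xi>) * f 1" using D by (simp add: D_def left_diff_distrib)
    have "f (1 - \<xi>) = (1 - \<xi>) * (f 1 + f 1)" using f_xi[of 1 1] by simp
    then have "(1 - \<xi>) * f 1 = 0" unfolding eq distrib_left by simp
    then have "f 1 = 0" using \<xi>(1) by simp
    then have f_Leibniz: "f (a * b) = f a * b + a * f b" for a b using f_mult by simp
    have "f \<xi> = 0" using D \<open>f 1 = 0\<close> by (simp add: D_def)
    show ?thesis
      unfolding additive_derivation_def additive_on_def scalar_ops_def
      by (auto simp: f f_add f_Leibniz \<open>f \<xi> = 0\<close> bop_scaleC_add_left mult.commute
          simp flip: bop_scaleC_add_left)
  qed
  then show "additive_derivation scalar_ops L" "A \<in> scalar_ops \<Longrightarrow> L (\<xi> *\<^sub>C A) = \<xi> *\<^sub>C L A" by auto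
qed

theorem theorem2p2:
  fixes M :: "'h::complex_hilbert bop set"
    and \<xi> :: complex
    and L :: "'h bop \<Rightarrow> 'h bop"
  assumes "factor M"
    and "\<xi> \<noteq> 0"
    and "additive_xi_lie_derivation \<xi> M L"
  shows "(\<xi> = 1 \<and> alg_deg M \<ge> 3 \<longrightarrow>
           (\<exists>(\<tau> :: 'h bop \<Rightarrow> 'h bop) (h :: 'h bop \<Rightarrow> complex).
              additive_derivation M \<tau> \<and>
              additive_on M h \<and>
              (\<forall>A\<in>M. \<forall>B\<in>M. h (A * B - B * A) = 0) \<and>
              (\<forall>A\<in>M. L A = \<tau> A + h A *\<^sub>C 1)))
       \<and> (\<xi> \<noteq> 1 \<and> (M = scalar_ops \<longrightarrow> algebraic \<xi>) \<longrightarrow>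
           additive_derivation M L \<and>
           (\<forall>A\<in>M. L (\<xi> *\<^sub>C A) = \<xi> *\<^sub>C L A))"
proof (intro conjI impI)
  assume "\<xi> = 1 \<and> alg_deg M \<ge> 3"
  then have L: "additive_xi_lie_derivation 1 M L" using assms(3) by simp
  note closed = von_neumann_closed[OF factor_von_neumann[OF assms(1)]]
  obtain \<tau> where \<tau>: "additive_derivation M \<tau>" and c: "\<And>A. A \<in> M \<Longrightarrow> \<exists>c. L A - \<tau> A = c *\<^sub>C 1"
    using factor_Lie_derivation[OF assms(1) L] by blast
  \<comment> \<open>The disjunction covers the zero space, where no unit vector exists but every
    vector is 0.\<close>
  have "\<exists>u::'h. \<forall>x::'h. norm u = 1 \<or> x = 0"
  proof (cases "\<exists>v::'h. v \<noteq> 0")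
    case True
    then obtain v :: 'h where "v \<noteq> 0" by blast
    then show ?thesis by (intro exI[of _ "(1 / norm v) *\<^sub>R v"]) simp
  qed auto
  then obtain u :: 'h where u: "\<And>x::'h. norm u = 1 \<or> x = 0" by blast
  \<comment> \<open>Reading the scalar off with a vector state makes \<open>h\<close> visibly
    additive, without choosing scalars one by one.\<close>
  define h where "h A = cinner (bop_apply (L A - \<tau> A) u) u" for A
  have h_eq: "L A - \<tau> A = h A *\<^sub>C 1" if A: "A \<in> M" for A
  proof (rule bop_eqI)
    fix x
    obtain c where c: "L A - \<tau> A = c *\<^sub>C 1" using c[OF A] by blast
    show "bop_apply (L A - \<tau> A) x = bop_apply (h A *\<^sub>C 1) x"
      using u[of x] unfolding h_def c by (auto simp: cinner_scaleC_left cinner_self)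
  qed
  have add: "L (A + B) = L A + L B" "\<tau> (A + B) = \<tau> A + \<tau> B" if "A \<in> M" "B \<in> M" for A B
    using L \<tau> that by (simp_all add: additive_xi_lie_derivation_def additive_derivation_def additive_on_def)
  have \<tau>_diff: "\<tau> (A - B) = \<tau> A - \<tau> B" if "A \<in> M" "B \<in> M" for A B
    using add(2)[of "A - B" B] closed that by simp
  show "\<exists>\<tau> h. additive_derivation M \<tau> \<and> additive_on M h \<and>
      (\<forall>A\<in>M. \<forall>B\<in>M. h (A * B - B * A) = 0) \<and> (\<forall>A\<in>M. L A = \<tau> A + h A *\<^sub>C 1)"
  proof (intro exI[of _ \<tau>] exI[of _ h] conjI ballI)
    show "additive_on M h"
      by (simp add: additive_on_def h_def add cinner_diff_left cinner_add_left)
    show "L A = \<tau> A + h A *\<^sub>C 1" if "A \<in> M" for A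
      using h_eq[OF that] by (simp add: algebra_simps)
    show "h (A * B - B * A) = 0" if A: "A \<in> M" and B: "B \<in> M" for A B
    proof -
      have L_comm: "L (A * B - B * A) = (L A * B - B * L A) + (A * L B - L B * A)"
        using L A B by (simp add: additive_xi_lie_derivation_def xi_commutator_def)
      have \<tau>_comm: "\<tau> (A * B - B * A) = (\<tau> A * B - B * \<tau> A) + (A * \<tau> B - \<tau> B * A)"
        using \<tau> A B closed by (simp add: \<tau>_diff additive_derivation_def)
      \<comment> \<open>\<open>L\<close> and \<tau> both satisfy the Lie identity, and their
        differences at \<open>A\<close> and \<open>B\<close> are scalars, whose commutators
        vanish.\<close>
      have "L (A * B - B * A) - \<tau> (A * B - B * A)
          = ((L A - \<tau> A) * B - B * (L A - \<tau> A)) + (A * (L B - \<tau> B) - (L B - \<tau> B) * A)"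
        unfolding L_comm \<tau>_comm by (simp add: algebra_simps)
      also have "\<dots> = 0" unfolding h_eq[OF A] h_eq[OF B] by simp
      finally show ?thesis unfolding h_def by simp
    qed
  qed (fact \<tau>)
next
  assume \<xi>: "\<xi> \<noteq> 1 \<and> (M = scalar_ops \<longrightarrow> algebraic \<xi>)"
  have all: "additive_derivation M L \<and> (\<forall>A\<in>M. L (\<xi> *\<^sub>C A) = \<xi> *\<^sub>C L A)"
  proof (cases "M = scalar_ops")
    case True
    then show ?thesis using scalar_xi_Lie_derivation assms(3) \<xi> by blast
  next
    case False
    show ?thesis
    proof (cases "\<xi> = - 1")
      case True
      then show ?thesis using factor_Jordan_derivation[OF assms(1) False] assms(3) by auto
    next
      case \<xi>': False
      show ?thesis using factor_xi_Lie_derivation[OF assms(1) False assms(3)] \<xi> \<xi>' by blast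
    qed
  qed
  then show "additive_derivation M L" and "\<forall>A\<in>M. L (\<xi> *\<^sub>C A) = \<xi> *\<^sub>C L A" by auto
qed

end
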